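(* Let $G=(V,E)$ be a finite decomposable graph. 1) If $r>0$, $x\in M_G$ and $N\sim\operatorname{nm}_G(r,x)$, then $$\mathbb P(N=n)=\frac{\prod_{C\in\mathcal C_G^+}\operatorname{nm}(r,x^C)(n_C)}{\prod_{S\in\mathcal S_G^-}\left(\operatorname{nm}(r,x^S)(n_S)\right)^{\nu_S}},\qquad n\in\mathbb N^V,$$ where, for a clique $C\in\mathcal C_G$, $x^C=(x_i^C)_{i\in C}$ with $x_i^C=x_i\,\Delta_{\mathfrak{nb}_{G^*}(i)}(x)/\Delta_{V\setminus C}(x)$. 2) If $r\in\{1,2,\ldots\}$, $y\in(0,\infty)^V$ and $N\sim\operatorname{mult}_G(r,y)$, then $$\mathbb P(N=n)=\frac{\prod_{C\in\mathcal C_G^+}\operatorname{mult}(r,y^C)(n_C)}{\prod_{S\in\mathcal S_G^-}\left(\operatorname{mult}(r,y^S)(n_S)\right)^{\nu_S}},\qquad n\in\mathbb N_{G,r},$$ where, for a clique $C\in\mathcal C_G$, $y^C=(y_i^C)_{i\in C}$ with $y_i^C=y_i\,\delta_{\mathfrak{nb}_{G^*}(i)}(y)/\delta_{V\setminus C}(y)$.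
   Context: $\mathbb N=\{0,1,2,\ldots\}$. $G=(V,E)$ is a finite undirected simple graph; $G^*$ is its complement graph; $G_A$ is the subgraph induced by $A\subset V$; $\mathfrak{nb}_{G^*}(i)$ is the set of neighbours of $i$ in $G^*$. A clique is a set of pairwise adjacent vertices ($\emptyset$ and singletons are cliques); $\mathcal C_G$ is the set of cliques and $\mathcal C_G^+$ the set of maximal cliques. $G$ is decomposable iff it is chordal (no induced cycle of length greater than 3); disconnected graphs are allowed. Minimal separators: if $G$ is decomposable, its maximal cliques admit a perfect ordering $C_1,\ldots,C_K$, i.e. for each $k\ge2$ there is $\ell<k$ with $S_k:=C_k\cap(C_1\cup\cdots\cup C_{k-1})\subset C_\ell$. $\mathcal S_G^-$ is the set of nonempty sets occurring among $S_2,\ldots,S_K$ and $\nu_S$ is the number of $k$ with $S_k=S$; these do not depend on the perfect ordering. Polynomials: $\Delta_G(x)=\sum_{C\in\mathcal C_{G^*}}(-1)^{|C|}\prod_{i\in C}x_i$, $\delta_G(y)=\sum_{C\in\mathcal C_{G^*}}\prod_{i\in C}y_i$; for $A\subset V$, $\Delta_A(x):=\Delta_{G_A}(x_A)$, $\delta_A(y):=\delta_{G_A}(y_A)$, $\Delta_\emptyset=\delta_\emptyset=1$. $M_G=\{x\in(0,\infty)^V:\Delta_A(x)>0\ \forall A\subset V\}$. Notation: $x_A=(x_i)_{i\in A}$, $x^n=\prod_i x_i^{n_i}$, $|n_A|=\sum_{i\in A}n_i$, $|n|=|n_V|$. For an integer $r\ge1$, $\binom{r}{n}_G$ is defined by $\delta_G(y)^r=\sum_{n\in\mathbb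 N^V}\binom{r}{n}_G y^n$; for real $r>0$, $\genfrac{[}{]}{0pt}{}{|n|+r-1}{n}_G$ is defined by the formal power series $\Delta_G(x)^{-r}=\sum_{n\in\mathbb N^V}\genfrac{[}{]}{0pt}{}{|n|+r-1}{n}_G x^n$. $N\sim\operatorname{nm}_G(r,x)$ means $\mathbb P(N=n)=\genfrac{[}{]}{0pt}{}{|n|+r-1}{n}_G\,x^n\Delta_G(x)^r$, $n\in\mathbb N^V$. $N\sim\operatorname{mult}_G(r,y)$ means $\mathbb P(N=n)=\binom{r}{n}_G\,y^n\delta_G(y)^{-r}$, $n\in\mathbb N_{G,r}:=\{n\in\mathbb N^V:\max_{C\in\mathcal C_G^+}|n_C|\le r\}$. For a finite set $A$: $\operatorname{nm}(r,v)(n)=\frac{\Gamma(|n|+r)}{\Gamma(r)\prod_{i\in A} n_i!}v^n(1-\sum_{i\in A}v_i)^r$ for $n\in\mathbb N^A$ (negative multinomial, $v\in(0,\infty)^A$, $\sum v_i<1$), and $\operatorname{mult}(r,v)(n)=\frac{r!}{(r-|n|)!\prod_{i\in A} n_i!}v^n(1+\sum_{i\in A}v_i)^{-r}$ for $n\in\mathbb N^A$, $|n|\le r$ (multinomial, $v\in(0,\infty)^A$). *)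

theory Defs
  imports "HOL-Probability.Probability" "HOL-Library.Poly_Mapping"
begin

section \<open>Graphs\<close>

record 'v graph =
  verts :: "'v set"
  adj :: "'v \<Rightarrow> 'v \<Rightarrow> bool"

definition finite_simple_graph :: "'v graph \<Rightarrow> bool" where
  "finite_simple_graph G \<longleftrightarrow> finite (verts G) \<and>
     (\<forall>i j. adj G i j \<longrightarrow> i \<in> verts G \<and> j \<in> verts G \<and> i \<noteq> j \<and> adj G j i)"

definition complement :: "'v graph \<Rightarrow> 'v graph" where
  "complement G = \<lparr>verts = verts G,
     adj = (\<lambda>i j. i \<in> verts G \<and> j \<in> verts G \<and> i \<noteq> j \<and> \<not> adj G i j)\<rparr>"

definition induced :: "'v graph \<Rightarrow> 'v set \<Rightarrow> 'v graph" where
  "induced G A = \<lparr>verts = A, adj = (\<lambda>i j. i \<in> A \<and> j \<in> A \<and> adj G i j)\<rparr>"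

definition nb :: "'v graph \<Rightarrow> 'v \<Rightarrow> 'v set" where
  "nb G i = {j \<in> verts G. adj G i j}"

definition cliques :: "'v graph \<Rightarrow> 'v set set" where
  "cliques G = {C. C \<subseteq> verts G \<and> (\<forall>i\<in>C. \<forall>j\<in>C. i \<noteq> j \<longrightarrow> adj G i j)}"

definition max_cliques :: "'v graph \<Rightarrow> 'v set set" where
  "max_cliques G = {C \<in> cliques G. \<forall>D \<in> cliques G. C \<subseteq> D \<longrightarrow> D = C}"

definition induced_cycle :: "'v graph \<Rightarrow> 'v list \<Rightarrow> bool" where
  "induced_cycle G vs \<longleftrightarrow> 3 \<le> length vs \<and> distinct vs \<and> set vs \<subseteq> verts G \<and>
     (\<forall>a<length vs. \<forall>b<length vs. adj G (vs ! a) (vs ! b) \<longleftrightarrow>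
        b = (a + 1) mod length vs \<or> a = (b + 1) mod length vs)"

definition decomposable :: "'v graph \<Rightarrow> bool" where
  "decomposable G \<longleftrightarrow> (\<forall>vs. induced_cycle G vs \<longrightarrow> length vs \<le> 3)"


section \<open>Minimal separators\<close>

text \<open>Positions in the list are counted from 0, so the set called \<open>S\<^sub>k\<close> in the literature,
  for \<open>k \<ge> 2\<close>, is \<open>sep Cs (k - 1)\<close>.\<close>

definition sep :: "'v set list \<Rightarrow> nat \<Rightarrow> 'v set" where
  "sep Cs k = Cs ! k \<inter> (\<Union>l<k. Cs ! l)"

definition perfect_ordering :: "'v graph \<Rightarrow> 'v set list \<Rightarrow> bool" where
  "perfect_ordering G Cs \<longleftrightarrow> distinct Cs \<and> set Cs = max_cliques G \<and>
     (\<forall>k. 1 \<le> k \<and> k < length Cs \<longrightarrow> (\<exists>l<k. sep Cs k \<subseteq> Cs ! l))"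

text \<open>A decomposable graph has a perfect ordering of its maximal cliques, and the separators and
  their multiplicities are the same for all of them, so the choice made here is immaterial.\<close>

definition some_perfect_ordering :: "'v graph \<Rightarrow> 'v set list" where
  "some_perfect_ordering G = (SOME Cs. perfect_ordering G Cs)"

definition min_separators :: "'v graph \<Rightarrow> 'v set set" where
  "min_separators G = (let Cs = some_perfect_ordering G in
     {sep Cs k | k. 1 \<le> k \<and> k < length Cs \<and> sep Cs k \<noteq> {}})"

definition sep_mult :: "'v graph \<Rightarrow> 'v set \<Rightarrow> nat" where
  "sep_mult G S = (let Cs = some_perfect_ordering G in
     card {k. 1 \<le> k \<and> k < length Cs \<and> sep Cs k = S})"


section \<open>Clique polynomials of the complement graph\<close>

text \<open>The polynomials are defined over an arbitrary commutative ring: at a real vector they give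
  the value, and at the vector \<^term>\<open>indet\<close> of indeterminates the formal polynomial.\<close>

definition Delta :: "'v graph \<Rightarrow> ('v \<Rightarrow> 'b) \<Rightarrow> 'b::comm_ring_1" where
  "Delta G x = (\<Sum>C \<in> cliques (complement G). (- 1) ^ card C * (\<Prod>i\<in>C. x i))"

definition delta :: "'v graph \<Rightarrow> ('v \<Rightarrow> 'b) \<Rightarrow> 'b::comm_ring_1" where
  "delta G y = (\<Sum>C \<in> cliques (complement G). \<Prod>i\<in>C. y i)"

definition indet :: "'v \<Rightarrow> ('v \<Rightarrow>\<^sub>0 nat) \<Rightarrow>\<^sub>0 real" where
  "indet i = Poly_Mapping.single (Poly_Mapping.single i 1) 1"

definition M_set :: "'v graph \<Rightarrow> ('v \<Rightarrow> real) set" where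
  "M_set G = {x. (\<forall>i \<in> verts G. 0 < x i) \<and> (\<forall>A \<subseteq> verts G. 0 < Delta (induced G A) x)}"


section \<open>Coefficients\<close>

text \<open>An element of \<open>\<nat>\<^sup>V\<close> is a finitely supported function vanishing off \<open>V\<close>, the same type
  as the exponents of monomials.\<close>

definition multi_indices :: "'v graph \<Rightarrow> ('v \<Rightarrow>\<^sub>0 nat) set" where
  "multi_indices G = {n. Poly_Mapping.keys n \<subseteq> verts G}"

definition total :: "'v set \<Rightarrow> ('v \<Rightarrow>\<^sub>0 nat) \<Rightarrow> nat" where
  "total A n = (\<Sum>i\<in>A. Poly_Mapping.lookup n i)"

definition monom_val :: "'v set \<Rightarrow> ('v \<Rightarrow> real) \<Rightarrow> ('v \<Rightarrow>\<^sub>0 nat) \<Rightarrow> real" where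
  "monom_val A v n = (\<Prod>i\<in>A. v i ^ Poly_Mapping.lookup n i)"

definition mult_coeff :: "'v graph \<Rightarrow> nat \<Rightarrow> ('v \<Rightarrow>\<^sub>0 nat) \<Rightarrow> real" where
  "mult_coeff G r n = Poly_Mapping.lookup (delta G indet ^ r) n"

text \<open>The real power of a formal power series with constant term 1 is given by the binomial series
  \<open>(1 + w)\<^sup>-\<^sup>r = \<Sum>\<^sub>k (-r gchoose k) w\<^sup>k\<close>. Here \<open>w = Delta - 1\<close> has no constant term, so
  only the powers \<open>k \<le> |n|\<close> contribute to the coefficient at \<open>n\<close>.\<close>

definition nm_coeff :: "'v graph \<Rightarrow> real \<Rightarrow> ('v \<Rightarrow>\<^sub>0 nat) \<Rightarrow> real" where
  "nm_coeff G r n = (\<Sum>k \<le> total (verts G) n.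
     ((- r) gchoose k) * Poly_Mapping.lookup ((Delta G indet - 1) ^ k) n)"


section \<open>Distributions\<close>

text \<open>\<open>N\<close> is a random element of the countable set \<open>U\<close> whose law is carried by \<open>A \<subseteq> U\<close> and has
  mass function \<open>p\<close> there.\<close>

definition has_mass_function ::
    "'w measure \<Rightarrow> ('w \<Rightarrow> 'b) \<Rightarrow> 'b set \<Rightarrow> 'b set \<Rightarrow> ('b \<Rightarrow> real) \<Rightarrow> bool" where
  "has_mass_function M N U A p \<longleftrightarrow>
     prob_space M \<and> N \<in> measurable M (count_space U) \<and> (AE \<omega> in M. N \<omega> \<in> A) \<and>
     (\<forall>n\<in>A. measure M {\<omega> \<in> space M. N \<omega> = n} = p n)"

definition nm_graph :: "'w measure \<Rightarrow> ('w \<Rightarrow> ('v \<Rightarrow>\<^sub>0 nat)) \<Rightarrow> 'v graph \<Rightarrow> real \<Rightarrow> ('v \<Rightarrow> real) \<Rightarrow> bool" where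
  "nm_graph M N G r x \<longleftrightarrow> has_mass_function M N (multi_indices G) (multi_indices G)
     (\<lambda>n. nm_coeff G r n * monom_val (verts G) x n * Delta G x powr r)"

definition mult_support :: "'v graph \<Rightarrow> nat \<Rightarrow> ('v \<Rightarrow>\<^sub>0 nat) set" where
  "mult_support G r = {n \<in> multi_indices G. \<forall>C \<in> max_cliques G. total C n \<le> r}"

definition mult_graph :: "'w measure \<Rightarrow> ('w \<Rightarrow> ('v \<Rightarrow>\<^sub>0 nat)) \<Rightarrow> 'v graph \<Rightarrow> nat \<Rightarrow> ('v \<Rightarrow> real) \<Rightarrow> bool" where
  "mult_graph M N G r y \<longleftrightarrow> has_mass_function M N (multi_indices G) (mult_support G r)
     (\<lambda>n. mult_coeff G r n * monom_val (verts G) y n / delta G y ^ r)"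

text \<open>Classical negative multinomial and multinomial mass functions on \<open>\<nat>\<^sup>A\<close>; only the restriction
  \<open>n\<^sub>A\<close> of the argument \<open>n\<close> enters.\<close>

definition nm_mass :: "'v set \<Rightarrow> real \<Rightarrow> ('v \<Rightarrow> real) \<Rightarrow> ('v \<Rightarrow>\<^sub>0 nat) \<Rightarrow> real" where
  "nm_mass A r v n = Gamma (real (total A n) + r) / (Gamma r * (\<Prod>i\<in>A. fact (Poly_Mapping.lookup n i)))
     * monom_val A v n * (1 - (\<Sum>i\<in>A. v i)) powr r"

definition mult_mass :: "'v set \<Rightarrow> nat \<Rightarrow> ('v \<Rightarrow> real) \<Rightarrow> ('v \<Rightarrow>\<^sub>0 nat) \<Rightarrow> real" where
  "mult_mass A r v n = fact r / (fact (r - total A n) * (\<Prod>i\<in>A. fact (Poly_Mapping.lookup n i)))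
     * monom_val A v n / (1 + (\<Sum>i\<in>A. v i)) ^ r"

definition nm_param :: "'v graph \<Rightarrow> ('v \<Rightarrow> real) \<Rightarrow> 'v set \<Rightarrow> 'v \<Rightarrow> real" where
  "nm_param G x C i =
     x i * Delta (induced G (nb (complement G) i)) x / Delta (induced G (verts G - C)) x"

definition mult_param :: "'v graph \<Rightarrow> ('v \<Rightarrow> real) \<Rightarrow> 'v set \<Rightarrow> 'v \<Rightarrow> real" where
  "mult_param G y C i =
     y i * delta (induced G (nb (complement G) i)) y / delta (induced G (verts G - C)) y"

end

theory Submission
  imports Defs "HOL-Computational_Algebra.Polynomial"
begin

text \<open>
  Each probability is a product of a coefficient, the monomial \<open>x\<^sup>n\<close> and a power of the normalizing
  polynomial, and so are the clique and separator mass functions. The proof fixes a perfect ordering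
  of the maximal cliques \<open>C k\<close> with separators \<open>S k\<close>, where \<open>S 0 = {}\<close>, and shows that each of the
  three kinds of factors telescopes when clique factors are divided by separator factors. That an
  ordering exists is Dirac's theorem on simplicial vertices (\<open>simplicial_nonneighbour\<close>), from
  which \<open>perfect_ordering_exists_induced\<close> rebuilds the graph vertex by vertex.

  Both polynomials are the independence polynomial of \<open>G\<close>, evaluated at \<open>-x\<close> for \<open>Delta\<close> and at \<open>y\<close> for
  \<open>delta\<close>. Write \<open>d A\<close> for its restriction to \<open>A\<close>. Since an independent set meets a clique in at most one
  vertex, 1 minus (for \<open>delta\<close>, plus) the sum of the parameters of a clique \<open>D\<close> is \<open>d V / d (V - D)\<close>.
  The normalizing constants and the monomials therefore only involve the products of \<open>d (V - C k)\<close> and of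
  \<open>d (V - S k)\<close>, over all \<open>k\<close> or over those with a given vertex in \<open>C k\<close>, respectively in \<open>S k\<close>. These are compared
  in \<open>prod_indep_poly_cliques_over_separators\<close>: a separator cuts the graph into two sides without crossing
  edges, \<open>d\<close> is multiplicative over the sides, and so each clique can be traded against its separator.

  For the coefficients, the coefficient of \<open>y\<^sup>n\<close> in \<open>delta\<^sup>r\<close> counts sequences of \<open>r\<close> independent
  sets. The vertices that the last clique adds to its separator can only be put into sets of the
  sequence that miss this separator, at most one into each; this gives one multinomial factor per clique
  (\<open>indep_power_coeff_peel\<close>), equal to the ratio of the clique coefficient and the separator
  coefficient. The coefficient of \<open>x\<^sup>n\<close> in \<open>Delta\<close> to the power \<open>- r\<close> is a polynomial in \<open>r\<close> whose values at negative
  integers are known from this count, which determines it for all real \<open>r\<close>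
  (\<open>nm_coeff_factorization\<close>).
\<close>

section \<open>Simplicial vertices of chordal graphs\<close>

text \<open>
  Simpliciality is taken relative to a vertex set \<open>A\<close>, so that the inductions below run over subsets
  of one fixed chordal graph and chordality never has to be transferred to an induced subgraph.
\<close>

definition simplicial_in :: "'v graph \<Rightarrow> 'v set \<Rightarrow> 'v \<Rightarrow> bool" where
  "simplicial_in G A z \<longleftrightarrow> z \<in> A \<and>
     (\<forall>v\<in>A. \<forall>w\<in>A. adj G z v \<longrightarrow> adj G z w \<longrightarrow> v \<noteq> w \<longrightarrow> adj G v w)"

lemma adj_sym: "finite_simple_graph G \<Longrightarrow> adj G i j \<longleftrightarrow> adj G j i"
  unfolding finite_simple_graph_def by blast

lemma adj_irrefl: "finite_simple_graph G \<Longrightarrow> \<not> adj G i i"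
  unfolding finite_simple_graph_def by blast

lemma adj_verts: "finite_simple_graph G \<Longrightarrow> adj G i j \<Longrightarrow> i \<in> verts G \<and> j \<in> verts G"
  unfolding finite_simple_graph_def by blast

text \<open>
  A vertex that sees exactly the two ends of a chordless path closes it up without creating a chord.
  The resulting cycle has \<open>n + 2 \<ge> 4\<close> vertices, which is what chordality excludes.
\<close>

lemma chordless_path_closes_to_induced_cycle:
  assumes G: "finite_simple_graph G"
    and p0: "adj G u (p 0)" and pn: "adj G u (p n)" and n: "2 \<le> n"
    and inner: "\<And>i. 0 < i \<Longrightarrow> i < n \<Longrightarrow> p i \<noteq> u \<and> \<not> adj G u (p i)"
    and step: "\<And>i. i < n \<Longrightarrow> adj G (p i) (p (Suc i))"
    and chordless: "\<And>i j. i < j \<Longrightarrow> j \<le> n \<Longrightarrow> adj G (p i) (p j) \<Longrightarrow> j = Suc i"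
    and ends: "p 0 \<noteq> p n"
  shows "induced_cycle G (u # map p [0..<Suc n])"
proof -
  have dist: "p i \<noteq> p j" if "i < j" "j \<le> n" for i j
  proof
    assume eq: "p i = p j"
    show False
    proof (cases "j < n")
      case True
      then have "adj G (p i) (p (Suc j))" using step[of j] eq by simp
      then show False using chordless[of i "Suc j"] that True by simp
    next
      case False
      then have jn: "j = n" using that by simp
      with eq ends that have i0: "0 < i" by (cases i) auto
      have "adj G (p (i - 1)) (p n)" using step[of "i - 1"] i0 eq jn that by simp
      moreover have "i - 1 < n" using that jn by linarith
      ultimately have "n = Suc (i - 1)" using chordless[of "i - 1" n] by simp
      then show False using that jn i0 by simp
    qed
  qed
  have neu: "p i \<noteq> u" if "i \<le> n" for i
    using inner[of i] p0 pn adj_irrefl[OF G] that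
    by (metis bot_nat_0.not_eq_extremum le_neq_implies_less)
  have adju: "adj G u (p i) \<longleftrightarrow> i = 0 \<or> i = n" if "i \<le> n" for i
    using inner[of i] p0 pn that by (metis bot_nat_0.not_eq_extremum le_neq_implies_less)
  have adjp: "adj G (p i) (p j) \<longleftrightarrow> j = Suc i \<or> i = Suc j" if "i \<le> n" "j \<le> n" for i j
  proof (cases i j rule: linorder_cases)
    case less
    then show ?thesis using chordless[of i j] step[of i] that by auto
  next
    case equal
    then show ?thesis using adj_irrefl[OF G] by auto
  next
    case greater
    then show ?thesis using chordless[of j i] step[of j] adj_sym[OF G] that by auto
  qed
  define vs where "vs = u # map p [0..<Suc n]"
  have len: "length vs = n + 2" by (simp add: vs_def)
  have nth0: "vs ! 0 = u" and nthS: "vs ! Suc k = p k" if "k \<le> n" for k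
    using that by (simp_all add: vs_def nth_append del: upt_Suc)
  have injp: "inj_on p {0..<Suc n}"
    unfolding inj_on_def using dist by (metis atLeastLessThan_iff less_Suc_eq_le linorder_neqE_nat)
  have d: "distinct vs"
    using injp neu by (force simp: vs_def distinct_map less_Suc_eq_le simp del: upt_Suc)
  have inV: "p i \<in> verts G" if "i \<le> n" for i
    using adj_verts[OF G] step[of i] pn that by (metis le_neq_implies_less)
  have sub: "set vs \<subseteq> verts G"
    using inV adj_verts[OF G p0] by (auto simp: vs_def less_Suc_eq_le simp del: upt_Suc)
  have "adj G (vs ! a) (vs ! b) \<longleftrightarrow>
        b = (a + 1) mod length vs \<or> a = (b + 1) mod length vs"
    if a: "a < length vs" and b: "b < length vs" for a b
  proof -
    have md: "(c + 1) mod length vs = (if c = n + 1 then 0 else c + 1)" if "c < length vs" for c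
      using that len by auto
    show ?thesis
    proof (cases a)
      case 0
      show ?thesis
      proof (cases b)
        case 0
        then show ?thesis using \<open>a = 0\<close> nth0 adj_irrefl[OF G] n md[OF a] len by auto
      next
        case (Suc k)
        then show ?thesis
          using \<open>a = 0\<close> nth0 nthS[of k] adju[of k] b len md[OF a] md[OF b] n by auto
      qed
    next
      case (Suc i)
      show ?thesis
      proof (cases b)
        case 0
        then show ?thesis
          using Suc nth0 nthS[of i] adju[of i] a len md[OF a] md[OF b] n adj_sym[OF G] by auto
      next
        case (Suc k)
        then show ?thesis
          using \<open>a = Suc i\<close> nthS[of k] nthS[of i] adjp[of i k] a b len md[OF a] md[OF b] n by auto
      qed
    qed
  qed
  then show ?thesis
    using d sub len n unfolding induced_cycle_def vs_def[symmetric] by auto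
qed

text \<open>
  Here chordality enters. If \<open>a\<close> and \<open>b\<close> were not adjacent, a shortest walk from \<open>a\<close> to \<open>b\<close> with
  interior in \<open>H\<close> would be a chordless path with at least two edges, and \<open>u\<close> would close it to a long
  induced cycle.
\<close>

lemma neighbours_joined_outside_are_adjacent:
  assumes G: "finite_simple_graph G" and D: "decomposable G"
    and ua: "adj G u a" and ub: "adj G u b" and ab: "a \<noteq> b"
    and H: "\<And>h. h \<in> H \<Longrightarrow> h \<noteq> u \<and> \<not> adj G u h"
    and h: "h \<in> H" "adj G a h" and h': "h' \<in> H" "adj G b h'"
    and conn: "(\<lambda>x y. adj G x y \<and> x \<in> H \<and> y \<in> H)\<^sup>*\<^sup>* h h'"
  shows "adj G a b"
proof (rule ccontr)
  assume nab: "\<not> adj G a b"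
  define walk where "walk n p \<longleftrightarrow> p 0 = a \<and> p n = b \<and> (\<forall>i<n. adj G (p i) (p (Suc i))) \<and>
     (\<forall>i. 0 < i \<and> i < n \<longrightarrow> p i \<in> H)" for n and p :: "nat \<Rightarrow> 'a"
  obtain m f where f: "f 0 = h" "f m = h'"
     "\<And>i. i < m \<Longrightarrow> adj G (f i) (f (Suc i)) \<and> f i \<in> H \<and> f (Suc i) \<in> H"
    using conn unfolding rtranclp_power relpowp_fun_conv by blast
  have fH: "f i \<in> H" if "i \<le> m" for i
    using f that h' by (metis le_neq_implies_less)
  define p0 where "p0 k = (if k = 0 then a else if k \<le> Suc m then f (k - 1) else b)" for k
  have "walk (Suc (Suc m)) p0"
    unfolding walk_def
  proof (intro conjI allI impI)
    fix i assume i: "i < Suc (Suc m)"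
    consider "i = 0" | "0 < i" "i \<le> m" | "i = Suc m" using i by linarith
    then show "adj G (p0 i) (p0 (Suc i))"
    proof cases
      case 1 then show ?thesis using f h by (simp add: p0_def)
    next
      case 2 then show ?thesis using f(3)[of "i - 1"] by (simp add: p0_def)
    next
      case 3 then show ?thesis using f h' adj_sym[OF G] by (simp add: p0_def)
    qed
  qed (auto simp: p0_def fH)
  then have ex: "\<exists>n p. walk n p" by blast
  define n where "n = (LEAST n. \<exists>p. walk n p)"
  obtain p where p: "walk n p" using LeastI_ex[OF ex] unfolding n_def by blast
  have least: "n \<le> k" if "walk k q" for k q
    unfolding n_def using that by (blast intro: Least_le)
  have chordless: "j = Suc i" if ij: "i < j" "j \<le> n" "adj G (p i) (p j)" for i j
  proof (rule ccontr)
    assume ne: "j \<noteq> Suc i"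
    \<comment> \<open>The chord from \<open>p i\<close> to \<open>p j\<close> gives a walk that is shorter by \<open>j - i - 1\<close> steps.\<close>
    define q where "q k = (if k \<le> i then p k else p (k + (j - i - 1)))" for k
    have "walk (n - (j - i - 1)) q"
      unfolding walk_def
    proof (intro conjI allI impI)
      show "q 0 = a" using p by (simp add: q_def walk_def)
      show "q (n - (j - i - 1)) = b" using p ij ne by (auto simp: q_def walk_def)
    next
      fix k assume k: "k < n - (j - i - 1)"
      consider "k < i" | "k = i" | "i < k" by linarith
      then show "adj G (q k) (q (Suc k))"
      proof cases
        case 1 then show ?thesis using p k by (simp add: q_def walk_def)
      next
        case 2 then show ?thesis using ij by (simp add: q_def)
      next
        case 3 then show ?thesis using p k ij by (simp add: q_def walk_def)
      qed
    next
      fix k assume "0 < k \<and> k < n - (j - i - 1)"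
      then show "q k \<in> H" using p ij by (auto simp: q_def walk_def)
    qed
    from least[OF this] ij ne show False by linarith
  qed
  have ends: "p 0 = a" "p n = b" and step: "\<And>i. i < n \<Longrightarrow> adj G (p i) (p (Suc i))"
    and inH: "\<And>i. 0 < i \<Longrightarrow> i < n \<Longrightarrow> p i \<in> H" using p by (auto simp: walk_def)
  have "2 \<le> n"
  proof (rule ccontr)
    assume "\<not> 2 \<le> n"
    then have "n = 0 \<or> n = 1" by linarith
    then show False using ends step[of 0] ab nab by auto
  qed
  then have "induced_cycle G (u # map p [0..<Suc n])"
    using G ua ub ab ends step inH H chordless
    by (intro chordless_path_closes_to_induced_cycle) auto
  then have "length (u # map p [0..<Suc n]) \<le> 3" using D unfolding decomposable_def by blast
  then show False using \<open>2 \<le> n\<close> by simp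
qed

text \<open>
  Dirac's theorem, in the form that supports induction: the simplicial vertex can be kept away from
  any prescribed vertex \<open>u\<close> that is not joined to everything. Let \<open>H\<close> be the component of \<open>w\<close> among
  the non-neighbours of \<open>u\<close>, and \<open>N\<close> the set of neighbours of \<open>u\<close> attached to \<open>H\<close>. Then \<open>N\<close> is a
  clique by the preceding lemma, and no neighbour of a vertex of \<open>H\<close> lies outside \<open>H \<union> N\<close>.
  So a vertex of \<open>H\<close> that is simplicial in the smaller set \<open>H \<union> N\<close> is simplicial in \<open>A\<close>.
\<close>

lemma simplicial_nonneighbour:
  assumes G: "finite_simple_graph G" and D: "decomposable G" and "finite A"
    and "u \<in> A" "w \<in> A" "w \<noteq> u" "\<not> adj G u w"
  shows "\<exists>z\<in>A. z \<noteq> u \<and> \<not> adj G u z \<and> simplicial_in G A z"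
  using assms(3-)
proof (induction "card A" arbitrary: A u w rule: less_induct)
  case less
  note sym = adj_sym[OF G]
  define B where "B = {v\<in>A. v \<noteq> u \<and> \<not> adj G u v}"
  define R where "R x y \<longleftrightarrow> adj G x y \<and> x \<in> B \<and> y \<in> B" for x y
  define H where "H = {v. R\<^sup>*\<^sup>* w v}"
  define N where "N = {a\<in>A. adj G u a \<and> (\<exists>h\<in>H. adj G a h)}"
  have wB: "w \<in> B" using less.prems by (simp add: B_def)
  have HB: "H \<subseteq> B"
  proof
    fix v assume "v \<in> H"
    then have "R\<^sup>*\<^sup>* w v" by (simp add: H_def)
    then show "v \<in> B" using wB by (induction) (auto simp: R_def)
  qed
  have wH: "w \<in> H" by (simp add: H_def)
  have Hclosed: "y \<in> H" if "x \<in> H" "adj G x y" "y \<in> B" for x y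
    using that HB rtranclp.rtrancl_into_rtrancl[of R w x y] unfolding H_def R_def by blast
  have symR: "symp R" unfolding symp_def R_def using sym by simp
  have conn: "R\<^sup>*\<^sup>* h h'" if "h \<in> H" "h' \<in> H" for h h'
  proof -
    have "R\<^sup>*\<^sup>* h w" using that symR unfolding H_def by (metis mem_Collect_eq sympD symp_rtranclp)
    then show ?thesis using that unfolding H_def by auto
  qed
  have Nclique: "adj G a b" if "a \<in> N" "b \<in> N" "a \<noteq> b" for a b
  proof -
    obtain h h' where hh: "h \<in> H" "adj G a h" "h' \<in> H" "adj G b h'" using \<open>a \<in> N\<close> \<open>b \<in> N\<close> unfolding N_def by blast
    have path: "(\<lambda>x y. adj G x y \<and> x \<in> B \<and> y \<in> B)\<^sup>*\<^sup>* h h'"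
      using conn[OF hh(1,3)] unfolding R_def by simp
    have "adj G u a" "adj G u b" using that by (auto simp: N_def)
    moreover have "h \<in> B" "h' \<in> B" using hh HB by auto
    moreover have "v \<noteq> u \<and> \<not> adj G u v" if "v \<in> B" for v using that by (simp add: B_def)
    ultimately show ?thesis
      using neighbours_joined_outside_are_adjacent[OF G D _ _ \<open>a \<noteq> b\<close> _ _ hh(2) _ hh(4) path] by blast
  qed
  define A' where "A' = H \<union> N"
  have A'A: "A' \<subset> A"
  proof -
    have "A' \<subseteq> A" unfolding A'_def N_def using HB B_def by blast
    moreover have "u \<notin> A'" unfolding A'_def N_def using HB B_def adj_irrefl[OF G] by blast
    ultimately show ?thesis using less.prems by blast
  qed
  have finA': "finite A'" and cardA': "card A' < card A"
    using A'A less.prems by (auto intro: finite_subset psubset_card_mono)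
  have nbH: "y \<in> A'" if "z \<in> H" "y \<in> A" "adj G z y" for z y
  proof (cases "y \<in> B")
    case True
    then show ?thesis using Hclosed that A'_def by blast
  next
    case False
    have "y \<noteq> u" using that HB sym[of z u] unfolding B_def by blast
    then have "adj G u y" using False that unfolding B_def by blast
    then show ?thesis using that sym[of z y] unfolding A'_def N_def by blast
  qed
  \<comment> \<open>To land in \<open>H\<close> rather than in \<open>N\<close>, the induction hypothesis is used at a vertex of \<open>N\<close> if
    possible, since its non-neighbours in \<open>A'\<close> avoid the clique \<open>N\<close>. If every vertex of \<open>N\<close> is joined to
    all of \<open>A'\<close>, any other vertex serves; if every vertex is, then \<open>A'\<close> is itself a clique.\<close>
  have "\<exists>z\<in>H. simplicial_in G A' z"
  proof (cases "\<exists>v\<in>N. \<exists>y\<in>A'. y \<noteq> v \<and> \<not> adj G v y")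
    case True
    then obtain v y where "v \<in> N" "y \<in> A'" "y \<noteq> v" "\<not> adj G v y" by blast
    with less.hyps[OF cardA' finA', of v y]
    obtain z where "z \<in> A'" "z \<noteq> v" "\<not> adj G v z" "simplicial_in G A' z"
      unfolding A'_def by blast
    then show ?thesis using Nclique[of v z] \<open>v \<in> N\<close> unfolding A'_def by blast
  next
    case Nuniv: False
    show ?thesis
    proof (cases "\<exists>v\<in>H. \<exists>y\<in>A'. y \<noteq> v \<and> \<not> adj G v y")
      case True
      then obtain v y where "v \<in> H" "y \<in> A'" "y \<noteq> v" "\<not> adj G v y" by blast
      with less.hyps[OF cardA' finA', of v y]
      obtain z where "z \<in> A'" "z \<noteq> v" "\<not> adj G v z" "simplicial_in G A' z"
        unfolding A'_def by blast
      moreover have "z \<notin> N"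
      proof
        assume "z \<in> N"
        moreover have "v \<in> A'" using \<open>v \<in> H\<close> by (simp add: A'_def)
        ultimately have "adj G z v" using Nuniv \<open>z \<noteq> v\<close> by metis
        then show False using \<open>\<not> adj G v z\<close> sym[of z v] by simp
      qed
      ultimately show ?thesis unfolding A'_def by blast
    next
      case False
      then have "adj G v y" if "v \<in> A'" "y \<in> A'" "y \<noteq> v" for v y
        using Nuniv that A'_def by (metis UnE)
      then have "simplicial_in G A' w"
        using wH by (simp add: simplicial_in_def A'_def)
      then show ?thesis using wH by blast
    qed
  qed
  then obtain z where z: "z \<in> H" "simplicial_in G A' z" by blast
  have "simplicial_in G A z"
    unfolding simplicial_in_def
  proof (intro conjI ballI impI)
    show "z \<in> A" using z A'A by (auto simp: simplicial_in_def)
    fix v w assume "v \<in> A" "w \<in> A" "adj G z v" "adj G z w" "v \<noteq> w"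
    then show "adj G v w" using z nbH[OF z(1)] by (simp add: simplicial_in_def)
  qed
  then show ?case using z HB unfolding B_def by blast
qed

lemma simplicial_vertex_exists:
  assumes G: "finite_simple_graph G" and D: "decomposable G" and "finite A" "A \<noteq> {}"
  shows "\<exists>z. simplicial_in G A z"
proof (cases "\<exists>u\<in>A. \<exists>w\<in>A. w \<noteq> u \<and> \<not> adj G u w")
  case True
  then show ?thesis using simplicial_nonneighbour[OF G D \<open>finite A\<close>] by blast
next
  case False
  then have "adj G v w" if "v \<in> A" "w \<in> A" "v \<noteq> w" for v w using that by metis
  moreover obtain z where "z \<in> A" using \<open>A \<noteq> {}\<close> by blast
  ultimately have "simplicial_in G A z" by (simp add: simplicial_in_def)
  then show ?thesis ..
qed

section \<open>Perfect orderings of the maximal cliques\<close>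

lemma cliques_induced: "cliques (induced G A) = {C. C \<subseteq> A \<and> (\<forall>i\<in>C. \<forall>j\<in>C. i \<noteq> j \<longrightarrow> adj G i j)}"
  unfolding cliques_def induced_def by auto

lemma clique_subset_max_clique:
  assumes "finite (verts G)" "C \<in> cliques G"
  shows "\<exists>D\<in>max_cliques G. C \<subseteq> D"
proof -
  have "finite (cliques G)"
    by (rule finite_subset[of _ "Pow (verts G)"]) (use assms in \<open>auto simp: cliques_def\<close>)
  then obtain D where "D \<in> cliques G" "C \<subseteq> D" "\<forall>b\<in>cliques G. D \<subseteq> b \<longrightarrow> D = b"
    using finite_has_maximal2[of "cliques G" C] assms by blast
  then show ?thesis unfolding max_cliques_def by blast
qed

text \<open>
  A clique through a simplicial vertex \<open>v\<close> lies in the closed neighbourhood of \<open>v\<close>, which is a clique.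
  Hence adding \<open>v\<close> creates one maximal clique and can destroy only \<open>N\<close>, which it extends.
\<close>

lemma max_cliques_insert_simplicial:
  assumes G: "finite_simple_graph G" and s: "simplicial_in G A v"
  defines "N \<equiv> {w\<in>A. adj G v w}"
  shows "max_cliques (induced G A) =
     insert (insert v N) (max_cliques (induced G (A - {v})) - {N})"
    and "N \<in> cliques (induced G (A - {v}))"
proof -
  have vA: "v \<in> A" using s by (simp add: simplicial_in_def)
  have vN: "v \<notin> N" using adj_irrefl[OF G] by (simp add: N_def)
  have Nadj: "adj G i j" if "i \<in> N" "j \<in> N" "i \<noteq> j" for i j
    using s that unfolding simplicial_in_def N_def by blast
  show Ncl: "N \<in> cliques (induced G (A - {v}))"
    using Nadj vN unfolding cliques_induced N_def by blast
  have vadj: "adj G v j" "adj G j v" if "j \<in> N" for j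
    using that adj_sym[OF G, of v j] by (simp_all add: N_def)
  have "N \<subseteq> A" by (auto simp: N_def)
  then have Qcl: "insert v N \<in> cliques (induced G A)"
    using Nadj vA vadj unfolding cliques_induced by blast
  have notv: "C \<in> cliques (induced G A) \<longleftrightarrow> C \<in> cliques (induced G (A - {v}))" if "v \<notin> C" for C
    using that unfolding cliques_induced by blast
  have withv: "C \<subseteq> insert v N" if "C \<in> cliques (induced G A)" "v \<in> C" for C
  proof
    fix w assume "w \<in> C"
    then have "w \<in> A" "w \<noteq> v \<Longrightarrow> adj G v w" using that by (auto simp: cliques_induced)
    then show "w \<in> insert v N" by (auto simp: N_def)
  qed
  have v': "v \<notin> C" if "C \<in> cliques (induced G (A - {v}))" for C
    using that unfolding cliques_induced by blast
  show "max_cliques (induced G A) =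
     insert (insert v N) (max_cliques (induced G (A - {v})) - {N})"
  proof (intro equalityI subsetI)
    fix C assume C: "C \<in> max_cliques (induced G A)"
    show "C \<in> insert (insert v N) (max_cliques (induced G (A - {v})) - {N})"
    proof (cases "v \<in> C")
      case True
      then show ?thesis using C withv[of C] Qcl unfolding max_cliques_def by blast
    next
      case False
      then have "C \<in> max_cliques (induced G (A - {v}))"
        using C notv v' unfolding max_cliques_def by blast
      moreover have "C \<noteq> N" using C Qcl vN unfolding max_cliques_def by blast
      ultimately show ?thesis by blast
    qed
  next
    fix C assume "C \<in> insert (insert v N) (max_cliques (induced G (A - {v})) - {N})"
    then consider "C = insert v N" | "C \<in> max_cliques (induced G (A - {v}))" "C \<noteq> N" by blast
    then show "C \<in> max_cliques (induced G A)"
    proof cases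
      case 1
      then show ?thesis using Qcl withv unfolding max_cliques_def by blast
    next
      case 2
      then have C': "C \<in> cliques (induced G (A - {v}))" "v \<notin> C"
        using v' unfolding max_cliques_def by blast+
      have "D = C" if "D \<in> cliques (induced G A)" "C \<subseteq> D" for D
      proof (cases "v \<in> D")
        case True
        then have "C \<subseteq> N" using withv[of D] that C' by blast
        then show ?thesis using 2 Ncl unfolding max_cliques_def by blast
      next
        case False
        then show ?thesis using 2 that notv unfolding max_cliques_def by blast
      qed
      then show ?thesis using C' notv unfolding max_cliques_def by blast
    qed
  qed
qed

text \<open>
  A simplicial vertex \<open>v\<close> is put back into a perfect ordering for \<open>A - {v}\<close>. If its neighbourhood \<open>N\<close>
  was a maximal clique, \<open>insert v N\<close> takes the place of \<open>N\<close> and no separator changes, because \<open>v\<close> is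
  in no other clique. Otherwise \<open>insert v N\<close> comes last, and its separator is contained in \<open>N\<close>, hence in an
  earlier clique.
\<close>

lemma perfect_ordering_exists_induced:
  assumes G: "finite_simple_graph G" and D: "decomposable G" and "finite A"
  shows "\<exists>Cs. perfect_ordering (induced G A) Cs"
  using \<open>finite A\<close>
proof (induction "card A" arbitrary: A)
  case 0
  then have "A = {}" by simp
  then have "max_cliques (induced G A) = {{}}" by (auto simp: max_cliques_def cliques_induced)
  then have "perfect_ordering (induced G A) [{}]" by (simp add: perfect_ordering_def)
  then show ?case by blast
next
  case (Suc m)
  then obtain v where s: "simplicial_in G A v"
    using simplicial_vertex_exists[OF G D, of A] by force
  define N where "N = {w\<in>A. adj G v w}"
  define Q where "Q = insert v N"
  note mc = max_cliques_insert_simplicial[OF G s, folded N_def, folded Q_def]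
  have vA: "v \<in> A" using s by (simp add: simplicial_in_def)
  obtain Cs where Cs: "perfect_ordering (induced G (A - {v})) Cs"
    using Suc.hyps(1)[of "A - {v}"] Suc.hyps(2) Suc.prems vA by force
  have dCs: "distinct Cs" and setCs: "set Cs = max_cliques (induced G (A - {v}))"
    and running_intersection: "\<And>k. 1 \<le> k \<Longrightarrow> k < length Cs \<Longrightarrow> \<exists>l<k. sep Cs k \<subseteq> Cs ! l"
    using Cs by (auto simp: perfect_ordering_def)
  have vCs: "Cs ! k \<subseteq> A - {v}" if "k < length Cs" for k
  proof -
    have "Cs ! k \<in> max_cliques (induced G (A - {v}))" using nth_mem[OF that] setCs by simp
    then show ?thesis unfolding max_cliques_def cliques_induced by blast
  qed
  have Qnew: "Q \<notin> set Cs" using vCs by (metis Diff_iff Q_def in_set_conv_nth insertCI subsetD)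
  show ?case
  proof (cases "N \<in> set Cs")
    case True
    then obtain j where j: "j < length Cs" "Cs ! j = N" by (metis in_set_conv_nth)
    define Cs' where "Cs' = Cs[j := Q]"
    have nth: "Cs' ! k = (if k = j then Q else Cs ! k)" if "k < length Cs" for k
      using that by (simp add: Cs'_def)
    have sep: "sep Cs' k = sep Cs k" if "k < length Cs" for k
    proof (rule set_eqI)
      fix x
      have mem: "x \<in> Cs' ! l \<longleftrightarrow> (if x = v then l = j else x \<in> Cs ! l)" if "l < length Cs" for l
        using nth[OF that] vCs[OF that] vCs[OF j(1)] j(2) by (auto simp: Q_def)
      have vno: "v \<notin> Cs ! l" if "l < length Cs" for l using vCs[OF that] by blast
      have "x \<in> sep Cs' k \<longleftrightarrow> x \<in> Cs' ! k \<and> (\<exists>l<k. x \<in> Cs' ! l)"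
        by (auto simp: sep_def)
      also have "\<dots> \<longleftrightarrow> x \<in> Cs ! k \<and> (\<exists>l<k. x \<in> Cs ! l)"
        using mem vno that by (metis less_irrefl less_trans)
      also have "\<dots> \<longleftrightarrow> x \<in> sep Cs k" by (auto simp: sep_def)
      finally show "x \<in> sep Cs' k \<longleftrightarrow> x \<in> sep Cs k" .
    qed
    have "perfect_ordering (induced G A) Cs'"
      unfolding perfect_ordering_def
    proof (intro conjI allI impI)
      show "distinct Cs'" unfolding Cs'_def using dCs Qnew by (intro distinct_list_update) auto
      show "set Cs' = max_cliques (induced G A)"
        unfolding Cs'_def mc using dCs j setCs by (simp add: set_update_distinct)
      fix k assume k: "1 \<le> k \<and> k < length Cs'"
      then obtain l where l: "l < k" "sep Cs k \<subseteq> Cs ! l" using running_intersection by (auto simp: Cs'_def)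
      then have "sep Cs' k \<subseteq> Cs' ! l"
        using sep[of k] nth[of l] k j by (auto simp: Cs'_def Q_def)
      then show "\<exists>l<k. sep Cs' k \<subseteq> Cs' ! l" using l by blast
    qed
    then show ?thesis by blast
  next
    case False
    define Cs' where "Cs' = Cs @ [Q]"
    have sep: "sep Cs' k = sep Cs k" if "k < length Cs" for k
      using that by (simp add: Cs'_def sep_def nth_append)
    have "finite (verts (induced G (A - {v})))" using Suc.prems by (simp add: induced_def)
    then obtain l where l: "l < length Cs" "N \<subseteq> Cs ! l"
      using clique_subset_max_clique mc(2) setCs by (metis in_set_conv_nth)
    have "sep Cs' (length Cs) \<subseteq> N"
      using vCs unfolding sep_def Cs'_def Q_def by (auto simp: nth_append)
    then have last: "sep Cs' (length Cs) \<subseteq> Cs' ! l" using l by (auto simp: Cs'_def nth_append)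
    have "perfect_ordering (induced G A) Cs'"
      unfolding perfect_ordering_def
    proof (intro conjI allI impI)
      show "distinct Cs'" unfolding Cs'_def using dCs Qnew by simp
      show "set Cs' = max_cliques (induced G A)"
        unfolding Cs'_def mc using False setCs by auto
      fix k assume k: "1 \<le> k \<and> k < length Cs'"
      show "\<exists>l<k. sep Cs' k \<subseteq> Cs' ! l"
      proof (cases "k < length Cs")
        case True
        then show ?thesis using running_intersection[of k] k sep[OF True] by (auto simp: Cs'_def nth_append)
      next
        case False
        then have "k = length Cs" using k by (simp add: Cs'_def)
        then show ?thesis using last l by blast
      qed
    qed
    then show ?thesis by blast
  qed
qed

lemma induced_verts: "finite_simple_graph G \<Longrightarrow> induced G (verts G) = G"
  unfolding induced_def finite_simple_graph_def by (cases G) auto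

lemma perfect_ordering_some:
  assumes "finite_simple_graph G" "decomposable G"
  shows "perfect_ordering G (some_perfect_ordering G)"
proof -
  have "finite (verts G)" using assms(1) by (simp add: finite_simple_graph_def)
  then have "\<exists>Cs. perfect_ordering G Cs"
    using perfect_ordering_exists_induced[OF assms, of "verts G"] induced_verts[OF assms(1)] by simp
  then show ?thesis unfolding some_perfect_ordering_def by (rule someI_ex)
qed

section \<open>Independence polynomials\<close>

text \<open>
  The cliques of the complement graph are the independent sets. Passing from \<open>G\<close> to subsets of its
  vertices, instead of to induced subgraphs, leaves a single function of a set \<open>A\<close> to work with.
\<close>

definition indep_sets :: "'v graph \<Rightarrow> 'v set \<Rightarrow> 'v set set" where
  "indep_sets G A = {I. I \<subseteq> A \<and> (\<forall>i\<in>I. \<forall>j\<in>I. \<not> adj G i j)}"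

definition indep_poly :: "'v graph \<Rightarrow> ('v \<Rightarrow> 'b) \<Rightarrow> 'v set \<Rightarrow> 'b::comm_ring_1" where
  "indep_poly G z A = (\<Sum>I \<in> indep_sets G A. \<Prod>i\<in>I. z i)"

lemma finite_indep_sets [simp]: "finite A \<Longrightarrow> finite (indep_sets G A)"
  by (rule finite_subset[of _ "Pow A"]) (auto simp: indep_sets_def)

lemma cliques_complement_induced:
  assumes "finite_simple_graph G"
  shows "cliques (complement (induced G A)) = indep_sets G A"
proof -
  have "(i \<in> A \<and> j \<in> A \<and> i \<noteq> j \<and> \<not> (i \<in> A \<and> j \<in> A \<and> adj G i j)) \<longleftrightarrow> i \<noteq> j \<and> \<not> adj G i j"
    if "i \<in> A" "j \<in> A" for i j using that by blast
  then show ?thesis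
    using adj_irrefl[OF assms]
    unfolding cliques_def complement_def induced_def indep_sets_def by (auto simp: subset_iff) metis
qed

lemma delta_induced:
  "finite_simple_graph G \<Longrightarrow> delta (induced G A) z = indep_poly G z A"
  by (simp add: delta_def indep_poly_def cliques_complement_induced)

text \<open>
  The two families of polynomials differ by the sign of the argument only, so everything below is
  done once, at real weights \<open>z\<close> of either sign.
\<close>

lemma Delta_induced:
  assumes "finite_simple_graph G"
  shows "Delta (induced G A) x = indep_poly G (\<lambda>i. - x i) A"
proof -
  have "(\<Prod>i\<in>I. - x i) = (-1) ^ card I * (\<Prod>i\<in>I. x i)" for I
    by (simp flip: prod_constant prod.distrib)
  then show ?thesis
    by (simp add: Delta_def indep_poly_def cliques_complement_induced[OF assms])
qed

lemma indep_poly_empty [simp]: "indep_poly G z {} = 1"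
proof -
  have "indep_sets G {} = {{}}" by (auto simp: indep_sets_def)
  then show ?thesis by (simp add: indep_poly_def)
qed

text \<open>
  An independent set of a disjoint union without crossing edges is an arbitrary pair of independent
  sets of the two parts.
\<close>

lemma indep_poly_Un:
  assumes G: "finite_simple_graph G" and fin: "finite A" "finite B" and dis: "A \<inter> B = {}"
    and sep: "\<And>a b. a \<in> A \<Longrightarrow> b \<in> B \<Longrightarrow> \<not> adj G a b"
  shows "indep_poly G z (A \<union> B) = indep_poly G z A * indep_poly G z B"
proof -
  have sep': "\<not> adj G b a" if "a \<in> A" "b \<in> B" for a b
    using sep[OF that] adj_sym[OF G, of a b] by simp
  have "indep_poly G z A * indep_poly G z B =
      (\<Sum>(I, J) \<in> indep_sets G A \<times> indep_sets G B. (\<Prod>i\<in>I. z i) * (\<Prod>i\<in>J. z i))"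
    by (simp add: indep_poly_def sum_product sum.cartesian_product)
  also have "\<dots> = (\<Sum>I \<in> indep_sets G (A \<union> B). \<Prod>i\<in>I. z i)"
  proof (rule sum.reindex_bij_witness[of _ "\<lambda>I. (I \<inter> A, I \<inter> B)" "\<lambda>(I, J). I \<union> J"])
    fix p assume p: "p \<in> indep_sets G A \<times> indep_sets G B"
    then obtain I J where IJ: "p = (I, J)" "I \<subseteq> A" "J \<subseteq> B" by (auto simp: indep_sets_def)
    then show "(case p of (I, J) \<Rightarrow> I \<union> J) \<in> indep_sets G (A \<union> B)"
      using p sep sep' by (auto simp: indep_sets_def subset_iff)
    show "((case p of (I, J) \<Rightarrow> I \<union> J) \<inter> A, (case p of (I, J) \<Rightarrow> I \<union> J) \<inter> B) = p"
      using IJ dis by auto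
    have "finite I" "finite J" "I \<inter> J = {}" using IJ fin dis finite_subset by blast+
    then show "(\<Prod>i\<in>(case p of (I, J) \<Rightarrow> I \<union> J). z i) =
        (case p of (I, J) \<Rightarrow> (\<Prod>i\<in>I. z i) * (\<Prod>i\<in>J. z i))"
      by (simp add: IJ(1) prod.union_disjoint)
  qed (auto simp: indep_sets_def)
  finally show ?thesis by (simp add: indep_poly_def)
qed

lemma nb_complement:
  "i \<in> verts G \<Longrightarrow> nb (complement G) i = {j \<in> verts G. j \<noteq> i \<and> \<not> adj G i j}"
  by (auto simp: nb_def complement_def)

text \<open>
  An independent set meets a clique \<open>D\<close> in at most one vertex. The summand \<open>f\<close> is arbitrary because
  the decomposition serves both the polynomial itself and the recursion for the coefficients of its
  powers.
\<close>

lemma sum_indep_sets_Un_clique: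
  assumes G: "finite_simple_graph G" and fin: "finite A" "finite D" and dis: "A \<inter> D = {}"
    and clq: "\<And>i j. i \<in> D \<Longrightarrow> j \<in> D \<Longrightarrow> i \<noteq> j \<Longrightarrow> adj G i j"
  shows "(\<Sum>I \<in> indep_sets G (A \<union> D). f I) = (\<Sum>I \<in> indep_sets G A. f I) +
    (\<Sum>i\<in>D. \<Sum>J \<in> indep_sets G {j\<in>A. \<not> adj G i j}. f (insert i J))"
proof -
  let ?N = "\<lambda>i. {j\<in>A. \<not> adj G i j}"
  have split: "indep_sets G (A \<union> D) =
      indep_sets G A \<union> (\<Union>i\<in>D. insert i ` indep_sets G (?N i))"
  proof (intro equalityI subsetI)
    fix I assume I: "I \<in> indep_sets G (A \<union> D)"
    show "I \<in> indep_sets G A \<union> (\<Union>i\<in>D. insert i ` indep_sets G (?N i))"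
    proof (cases "I \<inter> D = {}")
      case True
      then show ?thesis using I by (auto simp: indep_sets_def)
    next
      case False
      then obtain i where i: "i \<in> I" "i \<in> D" by blast
      have "I - {i} \<subseteq> ?N i"
      proof
        fix j assume j: "j \<in> I - {i}"
        then have "j \<in> A \<union> D" "\<not> adj G i j" using I i by (auto simp: indep_sets_def)
        then show "j \<in> ?N i" using clq[of i j] i j by auto
      qed
      then have "I - {i} \<in> indep_sets G (?N i)" using I by (auto simp: indep_sets_def)
      moreover have "I = insert i (I - {i})" using i by blast
      ultimately show ?thesis using i by blast
    qed
  next
    fix I assume "I \<in> indep_sets G A \<union> (\<Union>i\<in>D. insert i ` indep_sets G (?N i))"
    then consider "I \<in> indep_sets G A"
      | i J where "i \<in> D" "J \<in> indep_sets G (?N i)" "I = insert i J" by blast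
    then show "I \<in> indep_sets G (A \<union> D)"
    proof cases
      case 1
      then show ?thesis by (auto simp: indep_sets_def)
    next
      case 2
      then have "J \<subseteq> A" "\<And>j. j \<in> J \<Longrightarrow> \<not> adj G i j \<and> \<not> adj G j i"
        using adj_sym[OF G, of i] by (auto simp: indep_sets_def)
      then show ?thesis using 2 adj_irrefl[OF G, of i] by (auto simp: indep_sets_def)
    qed
  qed
  have JA: "J \<inter> D = {}" if "J \<in> indep_sets G (?N i)" for i J
    using that dis by (auto simp: indep_sets_def)
  have disj1: "indep_sets G A \<inter> (\<Union>i\<in>D. insert i ` indep_sets G (?N i)) = {}"
    using dis by (auto simp: indep_sets_def)
  have disj2: "insert i ` indep_sets G (?N i) \<inter> insert j ` indep_sets G (?N j) = {}"
    if ij: "i \<in> D" "j \<in> D" "i \<noteq> j" for i j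
  proof (rule equals0I)
    fix I assume I: "I \<in> insert i ` indep_sets G (?N i) \<inter> insert j ` indep_sets G (?N j)"
    then obtain J where J: "J \<in> indep_sets G (?N i)" "I = insert i J" by (elim IntE imageE)
    have "j \<in> I" using I by auto
    then show False using J(2) JA[OF J(1)] ij by auto
  qed
  have "(\<Sum>I \<in> insert i ` indep_sets G (?N i). f I) = (\<Sum>J \<in> indep_sets G (?N i). f (insert i J))"
    if i: "i \<in> D" for i
  proof -
    have "i \<notin> J" if "J \<in> indep_sets G (?N i)" for J using JA[OF that] i by auto
    then have "inj_on (insert i) (indep_sets G (?N i))"
      by (auto simp: inj_on_def insert_ident)
    then show ?thesis by (simp add: sum.reindex)
  qed
  moreover have "(\<Sum>I \<in> (\<Union>i\<in>D. insert i ` indep_sets G (?N i)). f I) =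
      (\<Sum>i\<in>D. \<Sum>I \<in> insert i ` indep_sets G (?N i). f I)"
    using fin disj2 by (intro sum.UNION_disjoint) auto
  ultimately show ?thesis
    unfolding split using fin disj1 by (subst sum.union_disjoint) auto
qed

lemma indep_poly_clique_expansion:
  assumes G: "finite_simple_graph G" and C: "C \<in> cliques G"
  shows "indep_poly G z (verts G) =
    indep_poly G z (verts G - C) + (\<Sum>i\<in>C. z i * indep_poly G z (nb (complement G) i))"
proof -
  let ?V = "verts G"
  have fin: "finite ?V" using G by (simp add: finite_simple_graph_def)
  have CV: "C \<subseteq> ?V" and Cadj: "\<And>i j. i \<in> C \<Longrightarrow> j \<in> C \<Longrightarrow> i \<noteq> j \<Longrightarrow> adj G i j"
    using C by (auto simp: cliques_def)
  have finC: "finite C" using CV fin by (rule finite_subset)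
  have nb: "{j \<in> ?V - C. \<not> adj G i j} = nb (complement G) i" if "i \<in> C" for i
    using that CV Cadj[OF that] nb_complement[of i G] by auto
  have prd: "(\<Prod>j\<in>insert i J. z j) = z i * (\<Prod>j\<in>J. z j)"
    if "i \<in> C" "J \<in> indep_sets G (nb (complement G) i)" for i J
  proof -
    have "J \<subseteq> ?V - C" using that nb[of i] by (auto simp: indep_sets_def)
    then have "i \<notin> J" "finite J" using that fin by (auto intro: finite_subset)
    then show ?thesis by simp
  qed
  have "?V = (?V - C) \<union> C" using CV by blast
  then have "indep_poly G z ?V = (\<Sum>I \<in> indep_sets G ((?V - C) \<union> C). \<Prod>j\<in>I. z j)"
    by (simp add: indep_poly_def)
  also have "\<dots> = indep_poly G z (?V - C) +
      (\<Sum>i\<in>C. \<Sum>J \<in> indep_sets G {j \<in> ?V - C. \<not> adj G i j}. \<Prod>j\<in>insert i J. z j)"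
    using fin finC Cadj by (subst sum_indep_sets_Un_clique[OF G]) (auto simp: indep_poly_def)
  also have "\<dots> = indep_poly G z (?V - C) + (\<Sum>i\<in>C. z i * indep_poly G z (nb (complement G) i))"
    unfolding indep_poly_def sum_distrib_left
    by (intro arg_cong2[of _ _ _ _ "(+)"] sum.cong refl) (auto simp only: nb prd)
  finally show ?thesis .
qed

section \<open>Separation along a perfect ordering\<close>

text \<open>
  From here on one perfect ordering \<open>C 0, \<dots>, C (K - 1)\<close> of the maximal cliques is fixed. With the
  convention \<open>S 0 = {}\<close> every clique has a separator, and all products over cliques and separators
  range over the same index set \<open>{..<K}\<close>. The set \<open>U k\<close> is covered by the first \<open>k\<close> cliques,
  and \<open>R k\<close> consists of the vertices that \<open>C k\<close> adds to it.
\<close>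

locale perfectly_ordered_graph =
  fixes G :: "'v graph" and Cs :: "'v set list"
  assumes G: "finite_simple_graph G" and perfect: "perfect_ordering G Cs"
begin

abbreviation "V \<equiv> verts G"
abbreviation "K \<equiv> length Cs"
abbreviation "C \<equiv> \<lambda>k. Cs ! k"
abbreviation "S \<equiv> sep Cs"

definition "U k = (\<Union>l<k. C l)"
definition "R k = C k - S k"

lemma finV: "finite V" using G by (simp add: finite_simple_graph_def)

lemma clique_C: "k < K \<Longrightarrow> C k \<in> cliques G"
  using perfect nth_mem[of k Cs] unfolding perfect_ordering_def max_cliques_def by auto

lemma C_sub: "k < K \<Longrightarrow> C k \<subseteq> V"
  using clique_C unfolding cliques_def by blast

lemma finC: "k < K \<Longrightarrow> finite (C k)"
  using C_sub finV finite_subset by blast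

lemma S_eq: "S k = C k \<inter> U k" by (simp add: sep_def U_def)

lemma S_sub: "S k \<subseteq> C k" by (simp add: sep_def)

lemma S_0 [simp]: "S 0 = {}" by (simp add: sep_def)

lemma U_0 [simp]: "U 0 = {}" by (simp add: U_def)

lemma U_Suc: "U (Suc k) = U k \<union> C k" by (auto simp: U_def lessThan_Suc)

lemma U_Suc_R: "U (Suc k) = U k \<union> R k" "U k \<inter> R k = {}"
  by (auto simp: U_Suc R_def S_eq)

lemma U_mono: "k \<le> l \<Longrightarrow> U k \<subseteq> U l" unfolding U_def by force

lemma running_intersection: "1 \<le> k \<Longrightarrow> k < K \<Longrightarrow> \<exists>l<k. S k \<subseteq> C l"
  using perfect unfolding perfect_ordering_def by blast

lemma clique_covered: "D \<in> cliques G \<Longrightarrow> \<exists>k<K. D \<subseteq> C k"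
  using clique_subset_max_clique[OF finV] perfect unfolding perfect_ordering_def
  by (metis in_set_conv_nth)

lemma vertex_covered: "i \<in> V \<Longrightarrow> \<exists>k<K. i \<in> C k"
  using clique_covered[of "{i}"] by (auto simp: cliques_def)

lemma edge_covered: "adj G i j \<Longrightarrow> \<exists>k<K. i \<in> C k \<and> j \<in> C k"
  using clique_covered[of "{i, j}"] adj_verts[OF G, of i j] adj_sym[OF G, of i j]
  by (auto simp: cliques_def)

lemma U_K: "U K = V"
  using vertex_covered C_sub unfolding U_def by blast

text \<open>
  The first clique containing both ends of the edge must be \<open>C j\<close>: it does not come earlier, since
  \<open>i\<close> is new in \<open>C j\<close>, and if it came later, both ends would lie in its separator and so already
  in an earlier clique.
\<close>

lemma edge_to_earlier_within_clique:
  assumes i: "i \<in> R j" and v: "v \<in> U (Suc j)" and a: "adj G i v"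
  shows "v \<in> C j"
proof -
  define m where "m = (LEAST k. k < K \<and> i \<in> C k \<and> v \<in> C k)"
  have m: "m < K" "i \<in> C m" "v \<in> C m"
    using LeastI_ex[OF edge_covered[OF a]] unfolding m_def by auto
  have least: "m \<le> l" if "l < K" "i \<in> C l" "v \<in> C l" for l
    unfolding m_def using that by (intro Least_le) simp
  have "j \<le> m"
  proof (rule ccontr)
    assume "\<not> j \<le> m"
    then have "i \<in> U j" using m(2) by (auto simp: U_def)
    then show False using i by (auto simp: R_def S_eq)
  qed
  moreover have "\<not> j < m"
  proof
    assume jm: "j < m"
    then have "U (Suc j) \<subseteq> U m" by (intro U_mono) simp
    moreover have "i \<in> U (Suc j)" using i by (simp add: U_Suc R_def)
    ultimately have "i \<in> S m" "v \<in> S m" using m v by (auto simp: S_eq)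
    moreover obtain l where "l < m" "S m \<subseteq> C l" using running_intersection[of m] jm m(1) by auto
    ultimately show False using least[of l] m(1) by auto
  qed
  ultimately have "m = j" by simp
  then show ?thesis using m by simp
qed

text \<open>
  The separator \<open>S j\<close> separates the part before \<open>C j\<close> from the new vertices of \<open>C j\<close>, even
  in the whole graph. Later cliques are added one by one: outside \<open>S j\<close> the separator of \<open>C m\<close>
  lies within an earlier clique, hence on one side, and the new vertices of \<open>C m\<close> go to that side.
\<close>

lemma separator_splits_prefix:
  assumes "Suc j \<le> m" "m \<le> K"
  shows "\<exists>A B. A \<union> B = U m - S j \<and> A \<inter> B = {} \<and> U j - S j \<subseteq> A \<and> R j \<subseteq> B \<and>
     (\<forall>k<m. C k - S j \<subseteq> A \<or> C k - S j \<subseteq> B)"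
  using assms
proof (induction m rule: dec_induct)
  case base
  have "C k - S j \<subseteq> U j - S j \<or> C k - S j \<subseteq> R j" if "k < Suc j" for k
  proof (cases "k = j")
    case False
    then have "k < j" using that by simp
    then have "C k \<subseteq> U j" by (auto simp: U_def)
    then show ?thesis by blast
  qed (simp add: R_def)
  moreover have "(U j - S j) \<union> R j = U (Suc j) - S j" "(U j - S j) \<inter> R j = {}"
    by (auto simp: R_def U_Suc S_eq)
  ultimately show ?case by (intro exI[of _ "U j - S j"] exI[of _ "R j"]) auto
next
  case (step m)
  then obtain A B where AB: "A \<union> B = U m - S j" "A \<inter> B = {}" "U j - S j \<subseteq> A" "R j \<subseteq> B"
    "\<forall>k<m. C k - S j \<subseteq> A \<or> C k - S j \<subseteq> B" by auto
  obtain l where l: "l < m" "S m \<subseteq> C l" using running_intersection[of m] step by auto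
  have SU: "S j \<subseteq> U m" using U_mono[of j m] step by (auto simp: S_eq)
  have RU: "R m \<inter> U m = {}" "U (Suc m) = U m \<union> R m" using U_Suc_R by auto
  have Cm: "C m - S j \<subseteq> (C l - S j) \<union> R m" using l by (auto simp: R_def)
  from AB(5) l(1) consider "C l - S j \<subseteq> A" | "C l - S j \<subseteq> B" by blast
  then show ?case
  proof cases
    case 1
    have "\<forall>k<Suc m. C k - S j \<subseteq> A \<union> R m \<or> C k - S j \<subseteq> B"
      using AB(5) Cm 1 by (auto simp: less_Suc_eq)
    moreover have "(A \<union> R m) \<union> B = U (Suc m) - S j" "(A \<union> R m) \<inter> B = {}"
      using AB SU RU by auto
    ultimately show ?thesis using AB by (intro exI[of _ "A \<union> R m"] exI[of _ B]) auto
  next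
    case 2
    have "\<forall>k<Suc m. C k - S j \<subseteq> A \<or> C k - S j \<subseteq> B \<union> R m"
      using AB(5) Cm 2 by (auto simp: less_Suc_eq)
    moreover have "A \<union> (B \<union> R m) = U (Suc m) - S j" "A \<inter> (B \<union> R m) = {}"
      using AB SU RU by auto
    ultimately show ?thesis using AB by (intro exI[of _ A] exI[of _ "B \<union> R m"]) auto
  qed
qed

text \<open>
  If \<open>S j\<close> splits the remaining vertices into sides \<open>A\<close> and \<open>B\<close>, then removing \<open>W\<close> only affects \<open>A\<close> and
  removing \<open>R j\<close> only affects \<open>B\<close>. All four polynomials factor over the two sides, and the
  identity merely rearranges the factors.
\<close>

lemma indep_poly_exchange:
  assumes j: "j < K" and W: "W \<subseteq> U j" "W \<inter> C j = S j"
  shows "indep_poly G z (V - W) * indep_poly G z (V - C j) =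
     indep_poly G z (V - (W \<union> C j)) * indep_poly G z (V - S j)"
proof -
  obtain A B where AB: "A \<union> B = V - S j" "A \<inter> B = {}" "U j - S j \<subseteq> A" "R j \<subseteq> B"
    "\<forall>k<K. C k - S j \<subseteq> A \<or> C k - S j \<subseteq> B"
    using separator_splits_prefix[of j K] j U_K by auto
  have noedge: "\<not> adj G a b" if "a \<in> A" "b \<in> B" for a b
  proof
    assume "adj G a b"
    then obtain k where k: "k < K" "a \<in> C k" "b \<in> C k" using edge_covered by blast
    then have "a \<in> C k - S j" "b \<in> C k - S j" using that AB(1) by blast+
    moreover have "C k - S j \<subseteq> A \<or> C k - S j \<subseteq> B" using AB(5) k(1) by blast
    ultimately show False using that AB(2) by blast
  qed
  have fin: "finite A" "finite B" using AB(1) finV by (metis finite_Diff finite_Un)+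
  have mult: "indep_poly G z (A' \<union> B') = indep_poly G z A' * indep_poly G z B'"
    if "A' \<subseteq> A" "B' \<subseteq> B" for A' B'
    using that fin AB(2) noedge finite_subset
    by (intro indep_poly_Un[OF G]) (blast | force)+
  have SC: "C j = S j \<union> R j" "S j \<inter> R j = {}" using S_sub by (auto simp: R_def)
  have CV: "C j \<subseteq> V" using C_sub j by blast
  have WB: "W \<inter> B = {}" using W(1) AB by blast
  have SW: "S j \<subseteq> W" using W(2) by blast
  have e: "V - W = (A - W) \<union> B" "V - C j = A \<union> (B - R j)"
    "V - (W \<union> C j) = (A - W) \<union> (B - R j)" "V - S j = A \<union> B"
    using AB SC WB SW by auto
  show ?thesis unfolding e using mult[of "A - W" B] mult[of A "B - R j"]
      mult[of "A - W" "B - R j"] mult[of A B] by (simp add: mult_ac)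
qed

text \<open>
  Restricting to the cliques that contain a given set \<open>T\<close> keeps the running intersection property,
  so the exchange identity can be applied along this subsequence. The two cases of interest are
  \<open>T = {}\<close>, which evaluates the normalizing constants, and \<open>T = {i}\<close>, which evaluates the
  power of \<open>x\<^sub>i\<close>. The index \<open>0\<close> is left out on the right because for \<open>T = {}\<close> the empty separator
  \<open>S 0\<close> would contribute a spurious factor.
\<close>

lemma prod_indep_poly_cliques_over_separators:
  assumes "j \<le> K" "\<exists>k<j. T \<subseteq> C k"
  shows "(\<Prod>k \<in> {k\<in>{..<j}. T \<subseteq> C k}. indep_poly G z (V - C k)) =
     indep_poly G z (V - (\<Union>k \<in> {k\<in>{..<j}. T \<subseteq> C k}. C k)) *
     (\<Prod>k \<in> {k\<in>{1..<j}. T \<subseteq> S k}. indep_poly G z (V - S k))"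
  using assms
proof (induction j)
  case 0
  then show ?case by simp
next
  case (Suc j)
  let ?P = "\<lambda>j. {k\<in>{..<j}. T \<subseteq> C k}" and ?Q = "\<lambda>j. {k\<in>{1..<j}. T \<subseteq> S k}"
  let ?W = "\<lambda>j. \<Union>k \<in> ?P j. C k"
  show ?case
  proof (cases "T \<subseteq> C j")
    case False
    then have "?P (Suc j) = ?P j" "?Q (Suc j) = ?Q j" using S_sub[of j]
      by (auto simp: less_Suc_eq)
    moreover have "\<exists>k<j. T \<subseteq> C k" using Suc.prems(2) False by (metis less_Suc_eq)
    ultimately show ?thesis using Suc.IH Suc.prems by simp
  next
    case True
    then have P: "?P (Suc j) = insert j (?P j)" "j \<notin> ?P j" by (auto simp: less_Suc_eq)
    show ?thesis
    proof (cases "\<exists>k<j. T \<subseteq> C k")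
      case False
      have no: "\<not> T \<subseteq> S k" if "1 \<le> k" "k \<le> j" for k
      proof
        assume "T \<subseteq> S k"
        moreover have "k < K" using that Suc.prems by linarith
        then obtain l where "l < k" "S k \<subseteq> C l" using running_intersection[of k] \<open>1 \<le> k\<close> by blast
        ultimately show False using False that by (meson dual_order.trans less_le_trans)
      qed
      have "?P (Suc j) = {j}" using False P(1) by auto
      moreover have "?Q (Suc j) = {}" using no by (auto simp: less_Suc_eq_le)
      ultimately show ?thesis by (simp only:) simp
    next
      case ex: True
      then have j1: "1 \<le> j" by auto
      have TS: "T \<subseteq> S j" using ex True by (auto simp: S_eq U_def)
      then have Q: "?Q (Suc j) = insert j (?Q j)" "j \<notin> ?Q j" using j1 by (auto simp: less_Suc_eq)
      obtain l where l: "l < j" "S j \<subseteq> C l" using running_intersection[of j] j1 Suc.prems by auto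
      have "?W j \<inter> C j = S j"
      proof
        show "?W j \<inter> C j \<subseteq> S j" by (auto simp: S_eq U_def)
        show "S j \<subseteq> ?W j \<inter> C j" using l TS S_sub[of j] by auto
      qed
      moreover have "?W j \<subseteq> U j" by (auto simp: U_def)
      ultimately have ex': "indep_poly G z (V - ?W j) * indep_poly G z (V - C j) =
         indep_poly G z (V - (?W j \<union> C j)) * indep_poly G z (V - S j)"
        using Suc.prems by (intro indep_poly_exchange) auto
      have "(\<Prod>k \<in> ?P (Suc j). indep_poly G z (V - C k)) =
          indep_poly G z (V - C j) * (\<Prod>k \<in> ?P j. indep_poly G z (V - C k))"
        using P by simp
      also have "\<dots> = (indep_poly G z (V - ?W j) * indep_poly G z (V - C j)) *
          (\<Prod>k \<in> ?Q j. indep_poly G z (V - S k))"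
        using Suc.IH Suc.prems ex by (simp add: mult_ac)
      also have "\<dots> = indep_poly G z (V - (?W j \<union> C j)) *
          (indep_poly G z (V - S j) * (\<Prod>k \<in> ?Q j. indep_poly G z (V - S k)))"
        unfolding ex' by (simp add: mult_ac)
      also have "?W j \<union> C j = ?W (Suc j)" unfolding P(1) by auto
      finally show ?thesis using Q by simp
    qed
  qed
qed

lemma K_pos: "0 < K"
  using clique_covered[of "{}"] by (auto simp: cliques_def)

lemma prod_indep_poly_all:
  "(\<Prod>k<K. indep_poly G z (V - S k)) =
     indep_poly G z V * (\<Prod>k<K. indep_poly G z (V - C k))"
proof -
  have "(\<Union>k<K. C k) = V" using U_K by (simp add: U_def)
  then have "(\<Prod>k<K. indep_poly G z (V - C k)) = (\<Prod>k\<in>{1..<K}. indep_poly G z (V - S k))"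
    using prod_indep_poly_cliques_over_separators[of K "{}" z] K_pos
    by (simp add: lessThan_def atLeastLessThan_def atLeast_def Int_def) blast
  moreover have "{..<K} = insert 0 {1..<K}" using K_pos by auto
  ultimately show ?thesis by simp
qed

text \<open>
  The cliques through \<open>i\<close> cover exactly \<open>i\<close> and its neighbours.
\<close>

lemma prod_indep_poly_containing:
  assumes i: "i \<in> V"
  shows "(\<Prod>k \<in> {k\<in>{..<K}. i \<in> C k}. indep_poly G z (V - C k)) =
     indep_poly G z (nb (complement G) i) *
     (\<Prod>k \<in> {k\<in>{..<K}. i \<in> S k}. indep_poly G z (V - S k))"
proof -
  have "j \<in> (\<Union>k \<in> {k\<in>{..<K}. i \<in> C k}. C k) \<longleftrightarrow> j = i \<or> adj G i j" if "j \<in> V" for j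
  proof
    assume "j = i \<or> adj G i j"
    then show "j \<in> (\<Union>k \<in> {k\<in>{..<K}. i \<in> C k}. C k)"
      using vertex_covered[OF i] edge_covered[of i j] by auto
  next
    assume "j \<in> (\<Union>k \<in> {k\<in>{..<K}. i \<in> C k}. C k)"
    then obtain k where "k < K" "i \<in> C k" "j \<in> C k" by auto
    then show "j = i \<or> adj G i j" using clique_C[of k] by (auto simp: cliques_def)
  qed
  then have nb: "V - (\<Union>k \<in> {k\<in>{..<K}. i \<in> C k}. C k) = nb (complement G) i"
    unfolding nb_complement[OF i] by blast
  have "{k\<in>{1..<K}. i \<in> S k} = {k\<in>{..<K}. i \<in> S k}"
    using S_0 by (auto simp: Suc_le_eq intro: gr0I)
  then show ?thesis
    using prod_indep_poly_cliques_over_separators[of K "{i}" z] vertex_covered[OF i] nb by auto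
qed

text \<open>
  A vertex of \<open>C k\<close> lies in \<open>S k\<close> unless \<open>C k\<close> is the first clique that contains it.
\<close>

lemma cliques_containing:
  assumes "i \<in> V"
  obtains k0 where "{k\<in>{..<K}. i \<in> C k} = insert k0 {k\<in>{..<K}. i \<in> S k}" "i \<notin> S k0" "k0 < K"
proof -
  define k0 where "k0 = (LEAST k. k < K \<and> i \<in> C k)"
  have k0: "k0 < K" "i \<in> C k0"
    using LeastI_ex[OF vertex_covered[OF assms]] unfolding k0_def by auto
  have least: "k0 \<le> k" if "k < K" "i \<in> C k" for k
    unfolding k0_def using that by (intro Least_le) simp
  have "i \<in> S k \<longleftrightarrow> i \<in> C k \<and> k \<noteq> k0" if "k < K" for k
  proof -
    have "i \<in> U k \<longleftrightarrow> k0 < k" 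
    proof
      assume "i \<in> U k"
      then obtain l where "l < k" "i \<in> C l" by (auto simp: U_def)
      then show "k0 < k" using least[of l] that by linarith
    qed (use k0 in \<open>auto simp: U_def\<close>)
    then show ?thesis using least[OF that] by (auto simp: S_eq)
  qed
  then show ?thesis using k0 that[of k0] by auto
qed

end

section \<open>Coefficients of powers of the independence polynomial\<close>

text \<open>
  This is the coefficient of \<open>y\<^sup>n\<close> in \<open>(1 + (\<Sum>i\<in>A. y i))\<close> raised to the real power \<open>s\<close>. Admitting all real
  \<open>s\<close> covers the multinomial and, at negative \<open>s\<close>, the negative multinomial coefficients.
\<close>

definition multinom :: "real \<Rightarrow> 'v set \<Rightarrow> ('v \<Rightarrow> nat) \<Rightarrow> real" where
  "multinom s A n = (s gchoose (\<Sum>i\<in>A. n i)) * fact (\<Sum>i\<in>A. n i) / (\<Prod>i\<in>A. fact (n i))"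

lemma multinom_cong: "(\<And>i. i \<in> A \<Longrightarrow> n i = m i) \<Longrightarrow> multinom s A n = multinom s A m"
  by (simp add: multinom_def)

text \<open>
  Pascal's rule, which expresses multiplication of the generating function by \<open>1 + (\<Sum>i\<in>A. y i)\<close>.
\<close>

lemma multinom_add_one:
  assumes "finite A"
  shows "multinom (s + 1) A n = multinom s A n +
    (\<Sum>i\<in>A. if 0 < n i then multinom s A (n(i := n i - 1)) else 0)"
proof (cases "\<Sum>i\<in>A. n i")
  case 0
  then show ?thesis using assms by (simp add: multinom_def)
next
  case (Suc N)
  let ?F = "\<Prod>i\<in>A. fact (n i) :: real"
  have F0: "?F \<noteq> 0" using assms by simp
  have one: "(if 0 < n i then multinom s A (n(i := n i - 1)) else 0) =
      (s gchoose N) * fact N * n i / ?F" if i: "i \<in> A" for i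
  proof (cases "0 < n i")
    case True
    have "(\<Sum>j\<in>A. n j) = n i + (\<Sum>j\<in>A - {i}. n j)"
      using assms i by (rule sum.remove)
    moreover have "(\<Sum>j\<in>A. (n(i := n i - 1)) j) = (n i - 1) + (\<Sum>j\<in>A - {i}. n j)"
      using assms i by (subst sum.remove[OF assms i]) simp
    ultimately have "(\<Sum>j\<in>A. (n(i := n i - 1)) j) = N" using Suc True by simp
    moreover have "?F = fact (n i) * (\<Prod>j\<in>A - {i}. fact (n j))"
      using assms i by (rule prod.remove)
    moreover have "(\<Prod>j\<in>A. fact ((n(i := n i - 1)) j) :: real) =
        fact (n i - 1) * (\<Prod>j\<in>A - {i}. fact (n j))"
      by (subst prod.remove[OF assms i]) simp
    moreover have "(fact (n i) :: real) = n i * fact (n i - 1)" using True by (simp add: fact_reduce)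
    ultimately show ?thesis using True assms by (simp add: multinom_def field_simps)
  qed simp
  have "(\<Sum>i\<in>A. if 0 < n i then multinom s A (n(i := n i - 1)) else 0) =
      (\<Sum>i\<in>A. (s gchoose N) * fact N * n i / ?F)"
    using one by simp
  also have "\<dots> = (s gchoose N) * fact N * real (\<Sum>i\<in>A. n i) / ?F"
    by (simp add: sum_distrib_left sum_divide_distrib)
  also have "\<dots> = (s gchoose N) * fact (Suc N) / ?F" by (simp add: Suc)
  finally show ?thesis
    by (simp add: multinom_def Suc gbinomial_Suc_Suc add_divide_distrib[symmetric] distrib_right)
qed

lemma multinom_0:
  assumes "finite A"
  shows "multinom 0 A n = (if \<forall>i\<in>A. n i = 0 then 1 else 0)"
proof (cases "\<Sum>i\<in>A. n i")
  case 0
  then show ?thesis using assms by (simp add: multinom_def)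
next
  case (Suc N)
  then have "\<not> (\<forall>i\<in>A. n i = 0)" by (metis nat.distinct(1) sum.neutral)
  then show ?thesis by (simp add: multinom_def Suc)
qed

text \<open>
  The coefficient of \<open>y\<^sup>n\<close> in the \<open>r\<close>-th power of the independence polynomial of \<open>A\<close>, that is, the number of
  sequences of \<open>r\<close> independent sets in which each \<open>i\<close> occurs \<open>n i\<close> times. The recursion splits off the
  first set of the sequence.
\<close>

primrec indep_power_coeff :: "'v graph \<Rightarrow> 'v set \<Rightarrow> nat \<Rightarrow> ('v \<Rightarrow> nat) \<Rightarrow> real" where
  "indep_power_coeff G A 0 n = (if \<forall>i\<in>A. n i = 0 then 1 else 0)"
| "indep_power_coeff G A (Suc r) n = (\<Sum>I \<in> indep_sets G A.
     if \<forall>i\<in>I. 0 < n i then indep_power_coeff G A r (\<lambda>i. n i - of_bool (i \<in> I)) else 0)"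

lemma indep_power_coeff_cong:
  "(\<And>i. i \<in> A \<Longrightarrow> n i = m i) \<Longrightarrow> indep_power_coeff G A r n = indep_power_coeff G A r m"
proof (induction r arbitrary: n m)
  case 0
  then show ?case by simp
next
  case (Suc r)
  have "(\<forall>i\<in>I. 0 < n i) \<longleftrightarrow> (\<forall>i\<in>I. 0 < m i)" if "I \<in> indep_sets G A" for I
    using that Suc.prems by (auto simp: indep_sets_def subset_iff)
  moreover have "indep_power_coeff G A r (\<lambda>i. n i - of_bool (i \<in> I)) =
      indep_power_coeff G A r (\<lambda>i. m i - of_bool (i \<in> I))" for I
    using Suc.prems by (intro Suc.IH) simp
  ultimately show ?case unfolding indep_power_coeff.simps by (intro sum.cong refl if_cong) auto
qed

lemma indep_power_coeff_empty: "indep_power_coeff G {} r n = 1"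
proof (induction r arbitrary: n)
  case (Suc r)
  have "indep_sets G {} = {{}}" by (auto simp: indep_sets_def)
  then show ?case using Suc by simp
qed simp

text \<open>
  Let \<open>R\<close> be attached to \<open>A\<close> through the clique \<open>S\<close>, with all of \<open>S \<union> R\<close> pairwise adjacent. In
  a sequence of \<open>r\<close> independent sets of \<open>A\<close> with multiplicities \<open>n\<close>, exactly \<open>(\<Sum>i\<in>S. n i)\<close> sets meet
  \<open>S\<close>, each in one vertex. Each of the others can receive at most one vertex of \<open>R\<close>, which accounts for
  the multinomial factor. The proof turns this count into an induction on \<open>r\<close>: depending on whether the first set
  \<open>I\<close> meets \<open>S\<close>, the upper parameter \<open>r + 1 - (\<Sum>i\<in>S. n i)\<close> stays as it is or drops by one, in which case
  Pascal's rule collects the choices for \<open>R\<close>.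
\<close>

lemma indep_power_coeff_peel:
  assumes G: "finite_simple_graph G" and fin: "finite A" "finite R" and dis: "A \<inter> R = {}"
    and SA: "S \<subseteq> A" and clq: "\<And>i j. i \<in> S \<union> R \<Longrightarrow> j \<in> S \<union> R \<Longrightarrow> i \<noteq> j \<Longrightarrow> adj G i j"
    and nonadj: "\<And>i v. i \<in> R \<Longrightarrow> v \<in> A \<Longrightarrow> adj G i v \<Longrightarrow> v \<in> S"
  shows "indep_power_coeff G (A \<union> R) r n =
    indep_power_coeff G A r n * multinom (real r - real (\<Sum>i\<in>S. n i)) R n"
proof (induction r arbitrary: n)
  case 0
  show ?case
  proof (cases "\<forall>i\<in>A. n i = 0")
    case True
    then have "(\<Sum>i\<in>S. n i) = 0" using SA by (auto intro: sum.neutral)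
    then show ?thesis using True fin by (simp add: multinom_0 ball_Un)
  qed (auto)
next
  case (Suc r)
  let ?s = "real (\<Sum>i\<in>S. n i)"
  let ?m = "\<lambda>I i. n i - of_bool (i \<in> I) :: nat"
  let ?c = "indep_power_coeff G A r"
  let ?g = "\<Sum>i\<in>R. if 0 < n i then multinom (real r - ?s) R (n(i := n i - 1)) else 0"
  have finS: "finite S" using SA fin finite_subset by blast
  have dec: "real (\<Sum>i\<in>S. ?m I i) = ?s - card (I \<inter> S)" if "\<forall>i\<in>I. 0 < n i" for I
  proof -
    have "(\<Sum>i\<in>S. ?m I i) + (\<Sum>i\<in>S. of_bool (i \<in> I)) = (\<Sum>i\<in>S. n i)"
      using that by (subst sum.distrib[symmetric], intro sum.cong) (auto simp: Suc_le_eq)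
    moreover have "(\<Sum>i\<in>S. of_bool (i \<in> I) :: nat) = card (I \<inter> S)"
      using finS by (simp add: sum.If_cases of_bool_def Int_commute Int_def)
    ultimately show ?thesis by linarith
  qed
  have AN: "{j\<in>A. \<not> adj G i j} = A - S" if "i \<in> R" for i
    using nonadj[OF that] clq[of i] SA dis that by blast
  have old: "indep_power_coeff G (A \<union> R) r (?m I) =
      ?c (?m I) * multinom (real r - (?s - card (I \<inter> S))) R n"
    if "I \<in> indep_sets G A" "\<forall>i\<in>I. 0 < n i" for I
  proof -
    have "multinom s R (?m I) = multinom s R n" for s
      using that(1) dis by (intro multinom_cong) (auto simp: indep_sets_def)
    then show ?thesis using Suc.IH[of "?m I"] dec[OF that(2)] by simp
  qed
  have new: "indep_power_coeff G (A \<union> R) r (?m (insert i J)) =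
      ?c (?m J) * multinom (real r - ?s) R (n(i := n i - 1))"
    if i: "i \<in> R" and J: "J \<in> indep_sets G (A - S)" and pos: "\<forall>j\<in>insert i J. 0 < n j" for i J
  proof -
    have JA: "J \<subseteq> A - S" using J by (auto simp: indep_sets_def)
    have "insert i J \<inter> S = {}" using JA i dis SA by blast
    moreover have "multinom s R (?m (insert i J)) = multinom s R (n(i := n i - 1))" for s
      using JA dis by (intro multinom_cong) auto
    moreover have "?c (?m (insert i J)) = ?c (?m J)"
      using i dis by (intro indep_power_coeff_cong) auto
    ultimately show ?thesis using Suc.IH[of "?m (insert i J)"] dec[OF pos] by simp
  qed
  have ok_insert: "(\<forall>j\<in>insert i J. 0 < n j) \<longleftrightarrow> 0 < n i \<and> (\<forall>j\<in>J. 0 < n j)" for i J by simp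
  have card1: "card (I \<inter> S) = 1" if I: "I \<in> indep_sets G A" and ne: "I \<inter> S \<noteq> {}" for I
  proof -
    obtain i where i: "i \<in> I \<inter> S" using ne by blast
    have "j = i" if "j \<in> I \<inter> S" for j
      using that i I clq[of j i] by (auto simp: indep_sets_def)
    then have "I \<inter> S = {i}" using i by blast
    then show ?thesis by simp
  qed
  have indepS: "indep_sets G (A - S) = {I \<in> indep_sets G A. I \<inter> S = {}}"
    by (auto simp: indep_sets_def)
  have "indep_power_coeff G (A \<union> R) (Suc r) n =
      (\<Sum>I \<in> indep_sets G A. if \<forall>i\<in>I. 0 < n i then indep_power_coeff G (A \<union> R) r (?m I) else 0) +
      (\<Sum>i\<in>R. \<Sum>J \<in> indep_sets G {j\<in>A. \<not> adj G i j}.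
         if \<forall>j\<in>insert i J. 0 < n j then indep_power_coeff G (A \<union> R) r (?m (insert i J)) else 0)"
    unfolding indep_power_coeff.simps
    using fin dis clq by (intro sum_indep_sets_Un_clique[OF G]) auto
  also have "(\<Sum>i\<in>R. \<Sum>J \<in> indep_sets G {j\<in>A. \<not> adj G i j}.
         if \<forall>j\<in>insert i J. 0 < n j then indep_power_coeff G (A \<union> R) r (?m (insert i J)) else 0) =
      (\<Sum>i\<in>R. \<Sum>J \<in> indep_sets G (A - S). (if \<forall>j\<in>J. 0 < n j then ?c (?m J) else 0) *
         (if 0 < n i then multinom (real r - ?s) R (n(i := n i - 1)) else 0))"
  proof (intro sum.cong)
    fix i J assume i: "i \<in> R" and "J \<in> indep_sets G (A - S)"
    then show "(if \<forall>j\<in>insert i J. 0 < n j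
          then indep_power_coeff G (A \<union> R) r (?m (insert i J)) else 0) =
        (if \<forall>j\<in>J. 0 < n j then ?c (?m J) else 0) *
        (if 0 < n i then multinom (real r - ?s) R (n(i := n i - 1)) else 0)"
      using new[of i J] by (cases "\<forall>j\<in>insert i J. 0 < n j") auto
  qed (simp_all add: AN)
  also have "\<dots> = (\<Sum>J \<in> indep_sets G (A - S). (if \<forall>j\<in>J. 0 < n j then ?c (?m J) else 0) * ?g)"
    by (subst sum.swap) (simp add: sum_distrib_left)
  also have "\<dots> = (\<Sum>I \<in> indep_sets G A. if I \<inter> S = {} then
       (if \<forall>j\<in>I. 0 < n j then ?c (?m I) else 0) * ?g else 0)"
    unfolding indepS using fin by (intro sum.mono_neutral_cong_left) auto
  also have "(\<Sum>I \<in> indep_sets G A. if \<forall>i\<in>I. 0 < n i then indep_power_coeff G (A \<union> R) r (?m I) else 0)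
      + \<dots> = (\<Sum>I \<in> indep_sets G A. (if \<forall>i\<in>I. 0 < n i then ?c (?m I) else 0) *
          multinom (real (Suc r) - ?s) R n)"
    unfolding sum.distrib[symmetric]
  proof (rule sum.cong[OF refl])
    fix I assume I: "I \<in> indep_sets G A"
    have "multinom (real (Suc r) - ?s) R n = multinom (real r - ?s) R n + ?g"
      using multinom_add_one[OF fin(2), of "real r - ?s" n] by (simp add: algebra_simps)
    then show "(if \<forall>i\<in>I. 0 < n i then indep_power_coeff G (A \<union> R) r (?m I) else 0) +
        (if I \<inter> S = {} then (if \<forall>j\<in>I. 0 < n j then ?c (?m I) else 0) * ?g else 0) =
        (if \<forall>i\<in>I. 0 < n i then ?c (?m I) else 0) * multinom (real (Suc r) - ?s) R n"
      using old[OF I] card1[OF I] by (auto simp: algebra_simps)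
  qed
  also have "\<dots> = indep_power_coeff G A (Suc r) n * multinom (real (Suc r) - ?s) R n"
    by (simp add: sum_distrib_right)
  finally show ?case .
qed

context perfectly_ordered_graph
begin

text \<open>
  The prefixes \<open>U j\<close> grow by one clique at a time, and by \<open>edge_to_earlier_within_clique\<close> the new
  vertices of \<open>C j\<close> are attached to \<open>U j\<close> through \<open>S j\<close> only.
\<close>

lemma indep_power_coeff_factorization:
  "indep_power_coeff G V r n =
     (\<Prod>k<K. multinom (real r - real (\<Sum>i\<in>S k. n i)) (R k) n)"
proof -
  have "indep_power_coeff G (U j) r n =
      (\<Prod>k<j. multinom (real r - real (\<Sum>i\<in>S k. n i)) (R k) n)" if "j \<le> K" for j
    using that
  proof (induction j)
    case 0
    then show ?case by (simp add: indep_power_coeff_empty)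
  next
    case (Suc j)
    then have j: "j < K" by simp
    have "U j \<subseteq> V" using U_mono[of j K] j U_K by simp
    then have fin: "finite (U j)" "finite (R j)"
      using finV finC[OF j] finite_subset by (auto simp: R_def)
    have SR: "S j \<union> R j = C j" using S_sub by (auto simp: R_def)
    have "indep_power_coeff G (U j \<union> R j) r n =
        indep_power_coeff G (U j) r n * multinom (real r - real (\<Sum>i\<in>S j. n i)) (R j) n"
    proof (rule indep_power_coeff_peel[OF G fin])
      show "U j \<inter> R j = {}" by (rule U_Suc_R)
      show "S j \<subseteq> U j" by (simp add: S_eq)
      show "adj G i v" if "i \<in> S j \<union> R j" "v \<in> S j \<union> R j" "i \<noteq> v" for i v
        using that clique_C[OF j] unfolding SR by (simp add: cliques_def)
      show "v \<in> S j" if "i \<in> R j" "v \<in> U j" "adj G i v" for i v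
        using edge_to_earlier_within_clique[of i j v] that by (simp add: U_Suc S_eq)
    qed
    then show ?case using Suc by (simp add: U_Suc_R(1))
  qed
  from this[of K] show ?thesis by (simp add: U_K)
qed

end

section \<open>Formal polynomials and real exponents\<close>

lemma lookup_single_mult:
  fixes m :: "'a::cancel_comm_monoid_add" and q :: "'a \<Rightarrow>\<^sub>0 'b::comm_ring_1"
  shows "Poly_Mapping.lookup (Poly_Mapping.single m a * q) n =
    a * (\<Sum>k. Poly_Mapping.lookup q k when n = m + k)"
  unfolding lookup_mult lookup_single by (simp add: when_mult)

lemma lookup_single_mult_add:
  fixes m :: "'a::cancel_comm_monoid_add" and q :: "'a \<Rightarrow>\<^sub>0 'b::comm_ring_1"
  shows "Poly_Mapping.lookup (Poly_Mapping.single m a * q) (m + k) = a * Poly_Mapping.lookup q k"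
  unfolding lookup_single_mult by simp

lemma lookup_single_mult_eq_0:
  fixes m :: "'a::cancel_comm_monoid_add" and q :: "'a \<Rightarrow>\<^sub>0 'b::comm_ring_1"
  assumes "\<And>k. n \<noteq> m + k"
  shows "Poly_Mapping.lookup (Poly_Mapping.single m a * q) n = 0"
  unfolding lookup_single_mult using assms by simp

definition ind_exp :: "'v set \<Rightarrow> 'v \<Rightarrow>\<^sub>0 nat" where
  "ind_exp I = (\<Sum>i\<in>I. Poly_Mapping.single i 1)"

lemma lookup_ind_exp: "finite I \<Longrightarrow> Poly_Mapping.lookup (ind_exp I) v = of_bool (v \<in> I)"
  by (simp add: ind_exp_def lookup_sum lookup_single when_def of_bool_def)

lemma prod_indet:
  assumes "finite I"
  shows "(\<Prod>i\<in>I. indet i) = Poly_Mapping.single (ind_exp I) 1"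
  using assms by (induction I rule: finite_induct)
    (simp_all add: indet_def ind_exp_def mult_single single_one)

text \<open>
  The formal independence polynomial with a weight on each independent set, which covers \<open>delta\<close>,
  \<open>Delta\<close> and \<open>Delta - 1\<close> at the vector of indeterminates.
\<close>

definition indep_gen :: "'v graph \<Rightarrow> ('v set \<Rightarrow> real) \<Rightarrow> ('v \<Rightarrow>\<^sub>0 nat) \<Rightarrow>\<^sub>0 real" where
  "indep_gen G w = (\<Sum>I \<in> indep_sets G (verts G). Poly_Mapping.single (ind_exp I) (w I))"

lemma lookup_indep_gen_mult:
  assumes "finite (verts G)"
  shows "Poly_Mapping.lookup (indep_gen G w * q) n = (\<Sum>I \<in> indep_sets G (verts G).
     if \<forall>i\<in>I. 0 < Poly_Mapping.lookup n i then w I * Poly_Mapping.lookup q (n - ind_exp I) else 0)"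
proof -
  have "Poly_Mapping.lookup (Poly_Mapping.single (ind_exp I) (w I) * q) n =
      (if \<forall>i\<in>I. 0 < Poly_Mapping.lookup n i then w I * Poly_Mapping.lookup q (n - ind_exp I) else 0)"
    if "I \<in> indep_sets G (verts G)" for I
  proof -
    have fin: "finite I" using that assms finite_subset unfolding indep_sets_def by blast
    show ?thesis
    proof (cases "\<forall>i\<in>I. 0 < Poly_Mapping.lookup n i")
      case True
      then have "n = ind_exp I + (n - ind_exp I)"
        by (intro poly_mapping_eqI) (auto simp: lookup_add lookup_minus lookup_ind_exp[OF fin] Suc_le_eq)
      then show ?thesis using True lookup_single_mult_add[of "ind_exp I" "w I" q "n - ind_exp I"] by simp
    next
      case False
      then obtain i where "i \<in> I" "Poly_Mapping.lookup n i = 0" by auto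
      then have "n \<noteq> ind_exp I + k" for k using lookup_ind_exp[OF fin, of i] by (auto simp: lookup_add)
      then have "Poly_Mapping.lookup (Poly_Mapping.single (ind_exp I) (w I) * q) n = 0"
        by (rule lookup_single_mult_eq_0)
      then show ?thesis using False by auto
    qed
  qed
  then show ?thesis by (simp add: indep_gen_def sum_distrib_right lookup_sum)
qed

lemma indep_sets_verts:
  "finite_simple_graph G \<Longrightarrow> cliques (complement G) = indep_sets G (verts G)"
  using cliques_complement_induced[of G "verts G"] by (simp add: induced_verts)

lemma delta_indet:
  assumes "finite_simple_graph G"
  shows "delta G indet = indep_gen G (\<lambda>_. 1)"
proof -
  have "finite I" if "I \<in> indep_sets G (verts G)" for I
    using that assms finite_subset unfolding indep_sets_def finite_simple_graph_def by blast
  then show ?thesis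
    by (simp add: delta_def indep_gen_def indep_sets_verts[OF assms] prod_indet)
qed

lemma Delta_indet:
  assumes "finite_simple_graph G"
  shows "Delta G indet = indep_gen G (\<lambda>I. (-1) ^ card I)"
proof -
  have fin: "finite I" if "I \<in> indep_sets G (verts G)" for I
    using that assms finite_subset unfolding indep_sets_def finite_simple_graph_def by blast
  have neg: "(-1) ^ k * Poly_Mapping.single m (1::real) = Poly_Mapping.single m ((-1) ^ k)" for k and m :: "'a \<Rightarrow>\<^sub>0 nat"
    by (induction k) (simp_all add: single_uminus)
  show ?thesis
    using fin by (simp add: Delta_def indep_gen_def indep_sets_verts[OF assms] prod_indet neg)
qed

lemma Delta_indet_minus_1:
  assumes "finite_simple_graph G"
  shows "Delta G indet - 1 = indep_gen G (\<lambda>I. if I = {} then 0 else (-1) ^ card I)"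
proof -
  have fin: "finite (indep_sets G (verts G))" using assms by (simp add: finite_simple_graph_def)
  have e: "{} \<in> indep_sets G (verts G)" by (simp add: indep_sets_def)
  show ?thesis
    unfolding Delta_indet[OF assms] indep_gen_def sum.remove[OF fin e]
    by (simp add: ind_exp_def)
qed

lemma total_minus_ind_exp:
  assumes fin: "finite A" and I: "I \<subseteq> A" and ok: "\<forall>i\<in>I. 0 < Poly_Mapping.lookup n i"
  shows "total A n = total A (n - ind_exp I) + card I"
proof -
  have finI: "finite I" using I fin by (rule finite_subset)
  have "total A (n - ind_exp I) + (\<Sum>i\<in>A. of_bool (i \<in> I)) = total A n"
    using ok unfolding total_def
    by (subst sum.distrib[symmetric], intro sum.cong)
       (auto simp: lookup_minus lookup_ind_exp[OF finI] Suc_le_eq)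
  moreover have "(\<Sum>i\<in>A. of_bool (i \<in> I) :: nat) = card I"
    using fin I by (simp add: sum.If_cases of_bool_def Int_absorb1 Int_def[symmetric])
  ultimately show ?thesis by simp
qed

lemma multi_indices_minus: "n \<in> multi_indices G \<Longrightarrow> n - m \<in> multi_indices G"
  unfolding multi_indices_def by (auto simp: in_keys_iff lookup_minus subset_iff)

text \<open>
  The sign parameter \<open>e\<close> is \<open>1\<close> for \<open>delta\<close> and \<open>-1\<close> for \<open>Delta\<close>; by homogeneity it only
  contributes a power of the total degree.
\<close>

lemma lookup_indep_gen_power:
  assumes G: "finite_simple_graph G" and n: "n \<in> multi_indices G"
  shows "Poly_Mapping.lookup (indep_gen G (\<lambda>I. e ^ card I) ^ r) n =
    e ^ total (verts G) n * indep_power_coeff G (verts G) r (Poly_Mapping.lookup n)"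
  using n
proof (induction r arbitrary: n)
  case 0
  have "n = 0 \<longleftrightarrow> (\<forall>i\<in>verts G. Poly_Mapping.lookup n i = 0)"
  proof
    assume z: "\<forall>i\<in>verts G. Poly_Mapping.lookup n i = 0"
    have "Poly_Mapping.lookup n i = 0" for i
      using z 0 by (cases "i \<in> verts G") (auto simp: multi_indices_def in_keys_iff subset_iff)
    then show "n = 0" by (intro poly_mapping_eqI) simp
  qed simp
  then show ?case by (auto simp: lookup_one total_def when_def)
next
  case (Suc r)
  have finV: "finite (verts G)" using G by (simp add: finite_simple_graph_def)
  show ?case
    unfolding power_Suc lookup_indep_gen_mult[OF finV] indep_power_coeff.simps sum_distrib_left
  proof (rule sum.cong[OF refl])
    fix I assume I: "I \<in> indep_sets G (verts G)"
    then have IV: "I \<subseteq> verts G" by (simp add: indep_sets_def)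
    then have finI: "finite I" using finV by (rule finite_subset)
    have lk: "Poly_Mapping.lookup (n - ind_exp I) = (\<lambda>i. Poly_Mapping.lookup n i - of_bool (i \<in> I))"
      by (simp add: fun_eq_iff lookup_minus lookup_ind_exp[OF finI])
    show "(if \<forall>i\<in>I. 0 < Poly_Mapping.lookup n i
          then e ^ card I * Poly_Mapping.lookup (indep_gen G (\<lambda>I. e ^ card I) ^ r) (n - ind_exp I) else 0) =
        e ^ total (verts G) n * (if \<forall>i\<in>I. 0 < Poly_Mapping.lookup n i
          then indep_power_coeff G (verts G) r (\<lambda>i. Poly_Mapping.lookup n i - of_bool (i \<in> I)) else 0)"
      using Suc.IH[OF multi_indices_minus[OF Suc.prems], of "ind_exp I"]
        total_minus_ind_exp[OF finV IV, of n]
      by (auto simp: lk power_add)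
  qed
qed

lemma mult_coeff_eq:
  assumes "finite_simple_graph G" "n \<in> multi_indices G"
  shows "mult_coeff G r n = indep_power_coeff G (verts G) r (Poly_Mapping.lookup n)"
  using lookup_indep_gen_power[OF assms, of 1 r]
  by (simp add: mult_coeff_def delta_indet[OF assms(1)])

text \<open>
  \<open>Delta - 1\<close> has no constant term, so its \<open>k\<close>-th power has only monomials of degree at least \<open>k\<close>.
\<close>

lemma lookup_Delta_minus_1_power:
  assumes G: "finite_simple_graph G" and "total (verts G) n < k"
  shows "Poly_Mapping.lookup ((Delta G indet - 1) ^ k) n = 0"
  using assms(2)
proof (induction k arbitrary: n)
  case 0
  then show ?case by simp
next
  case (Suc k)
  have finV: "finite (verts G)" using G by (simp add: finite_simple_graph_def)
  let ?w = "\<lambda>I. if I = {} then 0 else (-1) ^ card I :: real"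
  have D: "Delta G indet - 1 = indep_gen G ?w" by (rule Delta_indet_minus_1[OF G])
  have "(if \<forall>i\<in>I. 0 < Poly_Mapping.lookup n i then
      ?w I * Poly_Mapping.lookup ((Delta G indet - 1) ^ k) (n - ind_exp I) else 0) = 0"
    if "I \<in> indep_sets G (verts G)" for I
  proof (cases "I \<noteq> {} \<and> (\<forall>i\<in>I. 0 < Poly_Mapping.lookup n i)")
    case True
    have IV: "I \<subseteq> verts G" using that by (simp add: indep_sets_def)
    then have "0 < card I" using finV True finite_subset by (auto simp: card_gt_0_iff)
    then have "total (verts G) (n - ind_exp I) < k"
      using total_minus_ind_exp[OF finV IV] True Suc.prems by force
    then show ?thesis using Suc.IH by simp
  qed auto
  then show ?case
    unfolding power_Suc by (subst D) (simp add: lookup_indep_gen_mult[OF finV])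
qed

text \<open>
  At \<open>- r\<close> for a natural number \<open>r\<close> the binomial series is the finite binomial expansion of the
  \<open>r\<close>-th power of \<open>Delta\<close>. Truncating it at the degree of \<open>n\<close> changes nothing: the terms beyond
  \<open>r\<close> have a vanishing binomial coefficient, those beyond the degree a vanishing formal coefficient.
\<close>

lemma nm_coeff_at_neg_nat:
  assumes G: "finite_simple_graph G" and n: "n \<in> multi_indices G"
  shows "nm_coeff G (- real r) n =
    (-1) ^ total (verts G) n * indep_power_coeff G (verts G) r (Poly_Mapping.lookup n)"
proof -
  let ?w = "Delta G indet - 1 :: ('a \<Rightarrow>\<^sub>0 nat) \<Rightarrow>\<^sub>0 real"
  let ?t = "total (verts G) n"
  have lk: "Poly_Mapping.lookup (of_nat c * p) n = real c * Poly_Mapping.lookup p n"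
    for c and p :: "('a \<Rightarrow>\<^sub>0 nat) \<Rightarrow>\<^sub>0 real"
    by (induction c) (simp_all add: distrib_right lookup_add)
  have "Poly_Mapping.lookup (Delta G indet ^ r) n = Poly_Mapping.lookup ((?w + 1) ^ r) n" by simp
  also have "\<dots> = (\<Sum>k\<le>r. real (r choose k) * Poly_Mapping.lookup (?w ^ k) n)"
    by (subst binomial_ring) (simp add: lookup_sum lk mult.assoc)
  also have "\<dots> = (\<Sum>k\<le>r + ?t. real (r choose k) * Poly_Mapping.lookup (?w ^ k) n)"
    by (intro sum.mono_neutral_left) (auto simp: binomial_eq_0)
  also have "\<dots> = (\<Sum>k\<le>?t. real (r choose k) * Poly_Mapping.lookup (?w ^ k) n)"
    by (intro sum.mono_neutral_right) (auto simp: lookup_Delta_minus_1_power[OF G])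
  also have "\<dots> = nm_coeff G (- real r) n"
    by (simp add: nm_coeff_def binomial_gbinomial)
  finally show ?thesis
    using lookup_indep_gen_power[OF G n, of "-1" r] by (simp add: Delta_indet[OF G])
qed

definition is_polynomial :: "(real \<Rightarrow> real) \<Rightarrow> bool" where
  "is_polynomial f \<longleftrightarrow> (\<exists>p. \<forall>t. f t = poly p t)"

lemma is_polynomial_const: "is_polynomial (\<lambda>_. c)"
  unfolding is_polynomial_def by (intro exI[of _ "[:c:]"]) simp

lemma is_polynomial_shift: "is_polynomial (\<lambda>t. t - c)"
  unfolding is_polynomial_def by (intro exI[of _ "[:- c, 1:]"]) simp

lemma is_polynomial_add:
  "is_polynomial f \<Longrightarrow> is_polynomial g \<Longrightarrow> is_polynomial (\<lambda>t. f t + g t)"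
  unfolding is_polynomial_def by (metis poly_add)

lemma is_polynomial_mult:
  "is_polynomial f \<Longrightarrow> is_polynomial g \<Longrightarrow> is_polynomial (\<lambda>t. f t * g t)"
  unfolding is_polynomial_def by (metis poly_mult)

lemma is_polynomial_sum:
  "(\<And>i. i \<in> A \<Longrightarrow> is_polynomial (f i)) \<Longrightarrow> is_polynomial (\<lambda>t. \<Sum>i\<in>A. f i t)"
  by (induction A rule: infinite_finite_induct) (auto intro: is_polynomial_const is_polynomial_add)

lemma is_polynomial_prod:
  "(\<And>i. i \<in> A \<Longrightarrow> is_polynomial (f i)) \<Longrightarrow> is_polynomial (\<lambda>t. \<Prod>i\<in>A. f i t)"
  by (induction A rule: infinite_finite_induct) (auto intro: is_polynomial_const is_polynomial_mult)

lemma is_polynomial_gbinomial: "is_polynomial (\<lambda>t. (t - c) gchoose k)"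
proof -
  have "is_polynomial (\<lambda>t. (\<Prod>i = 0..<k. t - (c + real i)) * (1 / fact k))"
    by (intro is_polynomial_mult is_polynomial_prod is_polynomial_shift is_polynomial_const)
  then show ?thesis by (simp add: gbinomial_prod_rev diff_diff_eq)
qed

lemma is_polynomial_multinom: "is_polynomial (\<lambda>t. multinom (t - c) A n)"
proof -
  have "is_polynomial (\<lambda>t. ((t - c) gchoose (\<Sum>i\<in>A. n i)) *
      (fact (\<Sum>i\<in>A. n i) / (\<Prod>i\<in>A. fact (n i))))"
    by (intro is_polynomial_mult is_polynomial_gbinomial is_polynomial_const)
  then show ?thesis by (simp add: multinom_def)
qed

lemma is_polynomial_eqI:
  assumes "is_polynomial f" "is_polynomial g" and eq: "\<And>r::nat. f (real r) = g (real r)"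
  shows "f t = g t"
proof -
  obtain p q where p: "\<And>t. f t = poly p t" and q: "\<And>t. g t = poly q t"
    using assms(1,2) unfolding is_polynomial_def by metis
  have "range real \<subseteq> {t. poly (p - q) t = 0}" using eq p q by auto
  moreover have "infinite (range real)" by (simp add: finite_image_iff)
  ultimately have "infinite {t. poly (p - q) t = 0}" using finite_subset by blast
  then have "p - q = 0" using poly_roots_finite by blast
  then show ?thesis using p q by simp
qed

context perfectly_ordered_graph
begin

text \<open>
  For fixed \<open>n\<close> both sides are polynomials in \<open>s\<close>, and they agree at \<open>s = - r\<close> for every natural \<open>r\<close> by
  the count of sequences of independent sets.
\<close>

lemma nm_coeff_factorization:
  assumes n: "n \<in> multi_indices G"
  shows "nm_coeff G s n = (-1) ^ total V n *
     (\<Prod>k<K. multinom (- s - real (total (S k) n)) (R k) (Poly_Mapping.lookup n))"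
proof -
  let ?L = "\<lambda>t. nm_coeff G (- t) n"
  let ?R = "\<lambda>t. (-1) ^ total V n *
     (\<Prod>k<K. multinom (t - real (total (S k) n)) (R k) (Poly_Mapping.lookup n))"
  have "is_polynomial (\<lambda>t. \<Sum>k \<le> total V n. ((t - 0) gchoose k) *
      Poly_Mapping.lookup ((Delta G indet - 1) ^ k) n)"
    by (intro is_polynomial_sum is_polynomial_mult is_polynomial_gbinomial is_polynomial_const)
  then have "is_polynomial ?L" by (simp add: nm_coeff_def)
  moreover have "is_polynomial ?R"
    by (intro is_polynomial_mult is_polynomial_prod is_polynomial_multinom is_polynomial_const)
  moreover have "?L (real r) = ?R (real r)" for r
    using nm_coeff_at_neg_nat[OF G n, of r] indep_power_coeff_factorization[of r "Poly_Mapping.lookup n"]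
    by (simp add: total_def)
  ultimately have "?L (- s) = ?R (- s)" by (rule is_polynomial_eqI)
  then show ?thesis by simp
qed

lemma mult_coeff_factorization:
  assumes n: "n \<in> multi_indices G"
  shows "mult_coeff G r n =
     (\<Prod>k<K. multinom (real r - real (total (S k) n)) (R k) (Poly_Mapping.lookup n))"
  using mult_coeff_eq[OF G n] indep_power_coeff_factorization by (simp add: total_def)

end

section \<open>Factorization of the mass functions\<close>

lemma prod_fact_nonzero: "(\<Prod>i\<in>A. fact (f i) :: real) \<noteq> 0"
  by (cases "finite A") auto

context perfectly_ordered_graph
begin

lemma prod_max_cliques: "(\<Prod>D\<in>max_cliques G. f D) = (\<Prod>k<K. f (C k))"
proof -
  have "distinct Cs" "set Cs = max_cliques G" using perfect by (auto simp: perfect_ordering_def)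
  then have "bij_betw ((!) Cs) {..<K} (max_cliques G)" by (intro bij_betw_nth) auto
  then show ?thesis by (simp add: prod.reindex_bij_betw)
qed

text \<open>
  The multiplicities of the separators only count repetitions, and the empty separators, among them
  \<open>S 0\<close>, contribute the factor \<open>1\<close>.
\<close>

lemma prod_min_separators:
  assumes Cs: "Cs = some_perfect_ordering G" and f: "f {} = 1"
  shows "(\<Prod>D\<in>min_separators G. f D ^ sep_mult G D) = (\<Prod>k<K. f (S k) :: 'a::comm_monoid_mult)"
proof -
  let ?I = "{k. 1 \<le> k \<and> k < K \<and> S k \<noteq> {}}"
  have seps: "min_separators G = S ` ?I"
    by (auto simp: min_separators_def Cs Let_def)
  have "sep_mult G D = card {k \<in> ?I. S k = D}" if "D \<in> S ` ?I" for D
  proof -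
    have "{k. 1 \<le> k \<and> k < K \<and> S k = D} = {k \<in> ?I. S k = D}" using that by auto
    then show ?thesis by (simp add: sep_mult_def Let_def flip: Cs)
  qed
  then have "(\<Prod>D\<in>min_separators G. f D ^ sep_mult G D) =
      (\<Prod>D\<in>S ` ?I. \<Prod>k\<in>{k \<in> ?I. S k = D}. f (S k))"
    unfolding seps by (intro prod.cong refl) simp
  also have "\<dots> = (\<Prod>k\<in>?I. f (S k))" by (rule prod.image_gen[symmetric]) simp
  also have "\<dots> = (\<Prod>k<K. f (S k))"
  proof (rule prod.mono_neutral_left)
    show "\<forall>k\<in>{..<K} - ?I. f (S k) = 1"
    proof
      fix k assume "k \<in> {..<K} - ?I"
      then have "k = 0 \<or> S k = {}" by auto
      then show "f (S k) = 1" using f S_0 by metis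
    qed
  qed auto
  finally show ?thesis .
qed

lemma clique_S:
  assumes "k < K"
  shows "S k \<in> cliques G"
proof -
  have C: "C k \<subseteq> V" "\<And>i j. i \<in> C k \<Longrightarrow> j \<in> C k \<Longrightarrow> i \<noteq> j \<Longrightarrow> adj G i j"
    using clique_C[OF assms] by (auto simp: cliques_def)
  have S: "i \<in> C k" if "i \<in> S k" for i using that S_sub by blast
  have "S k \<subseteq> V" using C(1) S_sub by blast
  then show ?thesis unfolding cliques_def using C(2) S by simp
qed

lemma split_over_separator:
  assumes "k < K"
  shows "total (C k) n = total (S k) n + total (R k) n"
    and "(\<Prod>i\<in>C k. fact (Poly_Mapping.lookup n i) :: real) =
      (\<Prod>i\<in>S k. fact (Poly_Mapping.lookup n i)) * (\<Prod>i\<in>R k. fact (Poly_Mapping.lookup n i))"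
proof -
  have "C k = S k \<union> R k" "S k \<inter> R k = {}" using S_sub by (auto simp: R_def)
  moreover have "finite (S k)" "finite (R k)"
    using finC[OF assms] S_sub[of k] by (auto simp: R_def intro: finite_subset)
  ultimately show "total (C k) n = total (S k) n + total (R k) n"
    and "(\<Prod>i\<in>C k. fact (Poly_Mapping.lookup n i) :: real) =
      (\<Prod>i\<in>S k. fact (Poly_Mapping.lookup n i)) * (\<Prod>i\<in>R k. fact (Poly_Mapping.lookup n i))"
    by (simp_all add: total_def sum.union_disjoint prod.union_disjoint)
qed

lemma total_V: "total V n = (\<Sum>k<K. total (R k) n)"
proof -
  have "total (U j) n = (\<Sum>k<j. total (R k) n)" if "j \<le> K" for j
    using that
  proof (induction j)
    case 0
    then show ?case by (simp add: total_def)
  next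
    case (Suc j)
    have "U j \<subseteq> V" using U_mono[of j K] Suc.prems U_K by simp
    then have "finite (U j)" "finite (R j)"
      using finV finC[of j] Suc.prems finite_subset by (auto simp: R_def)
    then show ?case using Suc U_Suc_R[of j] by (simp add: total_def sum.union_disjoint)
  qed
  from this[of K] show ?thesis by (simp add: U_K)
qed

lemma prod_monom_val_swap:
  assumes "\<And>k. k < K \<Longrightarrow> D k \<subseteq> V"
  shows "(\<Prod>k<K. monom_val (D k) (v k) n) =
    (\<Prod>i\<in>V. (\<Prod>k\<in>{k\<in>{..<K}. i \<in> D k}. v k i) ^ Poly_Mapping.lookup n i)"
proof -
  have "(\<Prod>k<K. monom_val (D k) (v k) n) =
      (\<Prod>k<K. \<Prod>i\<in>{i. i \<in> V \<and> i \<in> D k}. v k i ^ Poly_Mapping.lookup n i)"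
  proof (rule prod.cong[OF refl])
    fix k assume "k \<in> {..<K}"
    then have "{i. i \<in> V \<and> i \<in> D k} = D k" using assms by auto
    then show "monom_val (D k) (v k) n =
        (\<Prod>i\<in>{i. i \<in> V \<and> i \<in> D k}. v k i ^ Poly_Mapping.lookup n i)"
      by (simp add: monom_val_def)
  qed
  also have "\<dots> = (\<Prod>i\<in>V. \<Prod>k\<in>{k. k \<in> {..<K} \<and> i \<in> D k}. v k i ^ Poly_Mapping.lookup n i)"
    using finV by (intro prod.swap_restrict) auto
  finally show ?thesis by (simp add: prod_power_distrib)
qed

text \<open>
  For each vertex \<open>i\<close> there is exactly one more clique than separators containing \<open>i\<close>, so a single factor
  \<open>a i\<close> survives, and the polynomials combine to that of the non-neighbours of \<open>i\<close>. The choice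
  \<open>a i = x i * indep_poly G z (nb (complement G) i)\<close> then makes the result \<open>x\<^sup>n\<close>.
\<close>

lemma prod_monom_val_ratio:
  assumes nz: "\<And>A. A \<subseteq> V \<Longrightarrow> indep_poly G z A \<noteq> 0"
    and a: "\<And>i. i \<in> V \<Longrightarrow> a i \<noteq> (0::real)"
  shows "(\<Prod>k<K. monom_val (C k) (\<lambda>i. a i / indep_poly G z (V - C k)) n) /
      (\<Prod>k<K. monom_val (S k) (\<lambda>i. a i / indep_poly G z (V - S k)) n) =
    monom_val V (\<lambda>i. a i / indep_poly G z (nb (complement G) i)) n"
proof -
  have SV: "S k \<subseteq> V" if "k < K" for k using C_sub[OF that] S_sub by blast
  have "(\<Prod>k\<in>{k\<in>{..<K}. i \<in> C k}. a i / indep_poly G z (V - C k)) /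
      (\<Prod>k\<in>{k\<in>{..<K}. i \<in> S k}. a i / indep_poly G z (V - S k)) =
      a i / indep_poly G z (nb (complement G) i)" if i: "i \<in> V" for i
  proof -
    obtain k0 where k0: "{k\<in>{..<K}. i \<in> C k} = insert k0 {k\<in>{..<K}. i \<in> S k}" "i \<notin> S k0"
      using cliques_containing[OF i] by blast
    have card: "card {k\<in>{..<K}. i \<in> C k} = Suc (card {k\<in>{..<K}. i \<in> S k})"
      unfolding k0(1) using k0(2) by simp
    have nz1: "(\<Prod>k\<in>{k\<in>{..<K}. i \<in> S k}. indep_poly G z (V - S k)) \<noteq> 0"
      using nz by (simp add: Diff_subset)
    have nz2: "indep_poly G z (nb (complement G) i) \<noteq> 0"
      using nz by (simp add: nb_def complement_def)
    show ?thesis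
      unfolding prod_dividef prod_constant card prod_indep_poly_containing[OF i]
      using nz1 nz2 a[OF i] by (simp add: field_simps)
  qed
  note ratio = this
  have "(\<Prod>k<K. monom_val (C k) (\<lambda>i. a i / indep_poly G z (V - C k)) n) /
      (\<Prod>k<K. monom_val (S k) (\<lambda>i. a i / indep_poly G z (V - S k)) n) =
      (\<Prod>i\<in>V. ((\<Prod>k\<in>{k\<in>{..<K}. i \<in> C k}. a i / indep_poly G z (V - C k)) /
        (\<Prod>k\<in>{k\<in>{..<K}. i \<in> S k}. a i / indep_poly G z (V - S k))) ^ Poly_Mapping.lookup n i)"
    by (simp only: prod_monom_val_swap[of C, OF C_sub] prod_monom_val_swap[of S, OF SV]
        power_divide prod_dividef)
  also have "\<dots> = (\<Prod>i\<in>V. (a i / indep_poly G z (nb (complement G) i)) ^ Poly_Mapping.lookup n i)"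
    by (intro prod.cong refl) (simp only: ratio)
  finally show ?thesis by (simp only: monom_val_def)
qed

text \<open>
  The expansion along a clique identifies the normalizing constant of the marginal distribution at \<open>D\<close>.
\<close>

lemma clique_normalizer:
  assumes D: "D \<in> cliques G" and nz: "indep_poly G z (V - D) \<noteq> (0::real)"
  shows "1 + (\<Sum>i\<in>D. z i * indep_poly G z (nb (complement G) i) / indep_poly G z (V - D)) =
    indep_poly G z V / indep_poly G z (V - D)"
proof -
  let ?d = "indep_poly G z (V - D)"
  have "indep_poly G z V / ?d =
      ?d / ?d + (\<Sum>i\<in>D. z i * indep_poly G z (nb (complement G) i)) / ?d"
    by (simp only: indep_poly_clique_expansion[OF G D] add_divide_distrib)
  then show ?thesis using nz by (simp add: sum_divide_distrib)
qed

lemma prod_normalizer_ratio: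
  assumes nz: "\<And>A. A \<subseteq> V \<Longrightarrow> indep_poly G z A \<noteq> (0::real)"
  shows "(\<Prod>k<K. indep_poly G z V / indep_poly G z (V - C k)) /
      (\<Prod>k<K. indep_poly G z V / indep_poly G z (V - S k)) = indep_poly G z V"
proof -
  have "(\<Prod>k<K. indep_poly G z (V - C k)) \<noteq> 0" "indep_poly G z V \<noteq> 0" using nz by auto
  then show ?thesis
    unfolding prod_dividef prod_constant prod_indep_poly_all by (simp add: field_simps)
qed

lemma nm_mass_empty: "0 < r \<Longrightarrow> nm_mass {} r v n = 1"
  by (simp add: nm_mass_def total_def monom_val_def Gamma_real_pos less_imp_neq[symmetric])

lemma mult_mass_empty: "mult_mass {} r v n = 1"
  by (simp add: mult_mass_def total_def monom_val_def)

text \<open>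
  The passage from \<open>S k\<close> to \<open>C k\<close> multiplies the negative multinomial coefficient by a quotient of Gamma
  values, which is a Pochhammer symbol and hence a multinomial coefficient at a negative upper parameter.
\<close>

lemma nm_coeff_ratio:
  fixes r :: real
  assumes r: "0 < r" and n: "n \<in> multi_indices G"
  defines "c \<equiv> \<lambda>A. Gamma (real (total A n) + r) / (Gamma r * (\<Prod>i\<in>A. fact (Poly_Mapping.lookup n i)))"
  shows "nm_coeff G r n = (\<Prod>k<K. c (C k)) / (\<Prod>k<K. c (S k))"
proof -
  have one: "c (C k) / c (S k) = (-1) ^ total (R k) n *
      multinom (- r - real (total (S k) n)) (R k) (Poly_Mapping.lookup n)" if k: "k < K" for k
  proof -
    let ?s = "real (total (S k) n) + r" and ?m = "total (R k) n"
    let ?FS = "\<Prod>i\<in>S k. fact (Poly_Mapping.lookup n i) :: real"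
    let ?FR = "\<Prod>i\<in>R k. fact (Poly_Mapping.lookup n i) :: real"
    have s: "0 < ?s" using r by simp
    then have "pochhammer ?s ?m = Gamma (?s + real ?m) / Gamma ?s"
      by (intro pochhammer_Gamma) (auto elim!: nonpos_Ints_cases)
    moreover have "- r - real (total (S k) n) = - ?s" by simp
    ultimately have R: "(-1) ^ ?m * multinom (- r - real (total (S k) n)) (R k) (Poly_Mapping.lookup n) =
        Gamma (?s + real ?m) / Gamma ?s / ?FR"
      unfolding multinom_def total_def[symmetric]
      by (simp add: gbinomial_pochhammer flip: power_mult_distrib mult.assoc)
    have "Gamma ?s > 0" "Gamma r > 0" using s r by (auto intro: Gamma_real_pos)
    moreover have "?FS \<noteq> 0" "?FR \<noteq> 0" by (rule prod_fact_nonzero)+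
    ultimately show ?thesis
      unfolding R c_def split_over_separator[OF k] by (simp add: field_simps)
  qed
  have "(-1) ^ total V n = (\<Prod>k<K. (-1 :: real) ^ total (R k) n)"
    by (simp add: total_V power_sum)
  then have "nm_coeff G r n = (\<Prod>k<K. c (C k) / c (S k))"
    using one by (simp add: nm_coeff_factorization[OF n] flip: prod.distrib)
  then show ?thesis by (simp add: prod_dividef)
qed

text \<open>
  The support condition bounds the total over each clique by \<open>r\<close>, which makes the truncated
  subtractions in the factorials exact.
\<close>

lemma mult_coeff_ratio:
  assumes n: "n \<in> mult_support G r"
  defines "c \<equiv> \<lambda>A. fact r / (fact (r - total A n) * (\<Prod>i\<in>A. fact (Poly_Mapping.lookup n i))) :: real"
  shows "mult_coeff G r n = (\<Prod>k<K. c (C k)) / (\<Prod>k<K. c (S k))"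
proof -
  have one: "c (C k) / c (S k) =
      multinom (real r - real (total (S k) n)) (R k) (Poly_Mapping.lookup n)" if k: "k < K" for k
  proof -
    let ?s = "total (S k) n" and ?m = "total (R k) n"
    let ?FS = "\<Prod>i\<in>S k. fact (Poly_Mapping.lookup n i) :: real"
    let ?FR = "\<Prod>i\<in>R k. fact (Poly_Mapping.lookup n i) :: real"
    have "C k \<in> max_cliques G" using k perfect nth_mem[of k Cs] by (auto simp: perfect_ordering_def)
    then have le: "?s + ?m \<le> r" using n split_over_separator(1)[OF k] by (auto simp: mult_support_def)
    then have "real r - real ?s = real (r - ?s)" by simp
    then have "(real r - real ?s) gchoose ?m = fact (r - ?s) / (fact ?m * fact (r - ?s - ?m))"
      using le binomial_fact[of ?m "r - ?s", where 'a = real]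
      by (simp only: binomial_gbinomial diff_diff_left)
    then have R: "multinom (real r - real ?s) (R k) (Poly_Mapping.lookup n) =
        fact (r - ?s) / fact (r - (?s + ?m)) / ?FR"
      unfolding multinom_def total_def[symmetric] by simp
    have "?FS \<noteq> 0" "?FR \<noteq> 0" by (rule prod_fact_nonzero)+
    then show ?thesis
      unfolding R c_def split_over_separator[OF k] by (simp add: field_simps)
  qed
  have "n \<in> multi_indices G" using n by (simp add: mult_support_def)
  then have "mult_coeff G r n = (\<Prod>k<K. c (C k) / c (S k))"
    using one by (simp add: mult_coeff_factorization)
  then show ?thesis by (simp add: prod_dividef)
qed

text \<open>
  Both sides split into a coefficient, a monomial and a normalizing factor, and the three ratios have been
  evaluated separately.
\<close>

lemma nm_mass_factorization:
  assumes Cs: "Cs = some_perfect_ordering G"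
    and r: "0 < r" and x: "x \<in> M_set G" and n: "n \<in> multi_indices G"
  shows "nm_coeff G r n * monom_val V x n * Delta G x powr r =
    (\<Prod>D\<in>max_cliques G. nm_mass D r (nm_param G x D) n) /
    (\<Prod>D\<in>min_separators G. nm_mass D r (nm_param G x D) n ^ sep_mult G D)"
proof -
  define z where "z i = - x i" for i
  define d where "d A = indep_poly G z A" for A
  define a where "a i = x i * d (nb (complement G) i)" for i
  have D: "Delta (induced G A) x = d A" for A
    using Delta_induced[OF G, of A x] unfolding d_def z_def .
  have DV: "Delta G x = d V" using D[of V] by (simp add: induced_verts[OF G])
  have pos: "0 < d A" if "A \<subseteq> V" for A using x that by (simp add: M_set_def D)
  have nb: "0 < d (nb (complement G) i)" for i by (rule pos) (auto simp: nb_def complement_def)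
  have a: "0 < a i" if "i \<in> V" for i using that x nb by (simp add: a_def M_set_def)
  have nz: "indep_poly G z A \<noteq> 0" if "A \<subseteq> V" for A using pos[OF that] by (simp add: d_def)
  have a0: "a i \<noteq> 0" if "i \<in> V" for i using a[OF that] by simp
  have param: "nm_param G x E = (\<lambda>i. a i / d (V - E))" for E
    by (simp add: nm_param_def D a_def fun_eq_iff)
  have norm: "1 - (\<Sum>i\<in>E. nm_param G x E i) = d V / d (V - E)" if "E \<in> cliques G" for E
    using clique_normalizer[OF that, of z] pos[of "V - E"]
    by (simp add: param a_def z_def sum_negf flip: d_def)
  define c where "c = (\<lambda>A. Gamma (real (total A n) + r) / (Gamma r * (\<Prod>i\<in>A. fact (Poly_Mapping.lookup n i))))"
  have mass: "nm_mass E r (nm_param G x E) n =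
      c E * monom_val E (\<lambda>i. a i / d (V - E)) n * (d V / d (V - E)) powr r" if "E \<in> cliques G" for E
    unfolding nm_mass_def norm[OF that] by (simp add: c_def param)
  have coeff: "(\<Prod>k<K. c (C k)) / (\<Prod>k<K. c (S k)) = nm_coeff G r n"
    using nm_coeff_ratio[OF r n] by (simp add: c_def)
  have "(\<Prod>k<K. monom_val (C k) (\<lambda>i. a i / d (V - C k)) n) /
      (\<Prod>k<K. monom_val (S k) (\<lambda>i. a i / d (V - S k)) n) =
      monom_val V (\<lambda>i. a i / d (nb (complement G) i)) n"
    unfolding d_def using nz a0 by (rule prod_monom_val_ratio)
  also have "\<dots> = monom_val V x n"
    using nb by (simp add: monom_val_def a_def less_imp_neq[symmetric])
  finally have mon: "(\<Prod>k<K. monom_val (C k) (\<lambda>i. a i / d (V - C k)) n) /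
      (\<Prod>k<K. monom_val (S k) (\<lambda>i. a i / d (V - S k)) n) = monom_val V x n" .
  have "(\<Prod>k<K. (d V / d (V - C k)) powr r) / (\<Prod>k<K. (d V / d (V - S k)) powr r) =
      ((\<Prod>k<K. d V / d (V - C k)) / (\<Prod>k<K. d V / d (V - S k))) powr r"
    by (simp only: prod_powr_distrib powr_divide prod_dividef)
  also have "(\<Prod>k<K. d V / d (V - C k)) / (\<Prod>k<K. d V / d (V - S k)) = d V"
    unfolding d_def using nz by (rule prod_normalizer_ratio)
  finally have nrm: "(\<Prod>k<K. (d V / d (V - C k)) powr r) / (\<Prod>k<K. (d V / d (V - S k)) powr r) =
      d V powr r" .
  have "(\<Prod>D\<in>max_cliques G. nm_mass D r (nm_param G x D) n) /
      (\<Prod>D\<in>min_separators G. nm_mass D r (nm_param G x D) n ^ sep_mult G D) =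
      (\<Prod>k<K. nm_mass (C k) r (nm_param G x (C k)) n) /
      (\<Prod>k<K. nm_mass (S k) r (nm_param G x (S k)) n)"
    using prod_min_separators[OF Cs, of "\<lambda>D. nm_mass D r (nm_param G x D) n", OF nm_mass_empty[OF r]]
    by (simp only: prod_max_cliques)
  also have "\<dots> = nm_coeff G r n * monom_val V x n * d V powr r"
    by (simp add: mass clique_C clique_S prod.distrib flip: coeff mon nrm)
  finally show ?thesis by (simp add: DV)
qed

lemma mult_mass_factorization:
  assumes Cs: "Cs = some_perfect_ordering G"
    and y: "\<And>i. i \<in> V \<Longrightarrow> 0 < y i" and n: "n \<in> mult_support G r"
  shows "mult_coeff G r n * monom_val V y n / delta G y ^ r =
    (\<Prod>D\<in>max_cliques G. mult_mass D r (mult_param G y D) n) /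
    (\<Prod>D\<in>min_separators G. mult_mass D r (mult_param G y D) n ^ sep_mult G D)"
proof -
  define d where "d A = indep_poly G y A" for A
  define a where "a i = y i * d (nb (complement G) i)" for i
  have D: "delta (induced G A) y = d A" for A
    using delta_induced[OF G] by (simp add: d_def)
  have DV: "delta G y = d V" using D[of V] by (simp add: induced_verts[OF G])
  have pos: "0 < d A" if A: "A \<subseteq> V" for A
  proof -
    have "finite (indep_sets G A)" using A finV finite_subset by (intro finite_indep_sets)
    moreover have "{} \<in> indep_sets G A" by (simp add: indep_sets_def)
    moreover have "0 \<le> (\<Prod>i\<in>I. y i)" if "I \<in> indep_sets G A" for I
      using that A y by (intro prod_nonneg) (force simp: indep_sets_def)
    ultimately show ?thesis unfolding d_def indep_poly_def by (intro sum_pos2[of _ "{}"]) auto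
  qed
  have nb: "0 < d (nb (complement G) i)" for i by (rule pos) (auto simp: nb_def complement_def)
  have a: "0 < a i" if "i \<in> V" for i using that y nb by (simp add: a_def)
  have nz: "indep_poly G y A \<noteq> 0" if "A \<subseteq> V" for A using pos[OF that] by (simp add: d_def)
  have a0: "a i \<noteq> 0" if "i \<in> V" for i using a[OF that] by simp
  have param: "mult_param G y E = (\<lambda>i. a i / d (V - E))" for E
    by (simp add: mult_param_def D a_def fun_eq_iff)
  have norm: "1 + (\<Sum>i\<in>E. mult_param G y E i) = d V / d (V - E)" if "E \<in> cliques G" for E
    using clique_normalizer[OF that, of y] pos[of "V - E"]
    by (simp add: param a_def flip: d_def)
  define c where "c = (\<lambda>A. fact r / (fact (r - total A n) * (\<Prod>i\<in>A. fact (Poly_Mapping.lookup n i))) :: real)"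
  have mass: "mult_mass E r (mult_param G y E) n =
      c E * monom_val E (\<lambda>i. a i / d (V - E)) n / (d V / d (V - E)) ^ r" if "E \<in> cliques G" for E
    unfolding mult_mass_def norm[OF that] by (simp add: c_def param)
  have coeff: "(\<Prod>k<K. c (C k)) / (\<Prod>k<K. c (S k)) = mult_coeff G r n"
    using mult_coeff_ratio[OF n] by (simp add: c_def)
  have "(\<Prod>k<K. monom_val (C k) (\<lambda>i. a i / d (V - C k)) n) /
      (\<Prod>k<K. monom_val (S k) (\<lambda>i. a i / d (V - S k)) n) =
      monom_val V (\<lambda>i. a i / d (nb (complement G) i)) n"
    unfolding d_def using nz a0 by (rule prod_monom_val_ratio)
  also have "\<dots> = monom_val V y n"
    using nb by (simp add: monom_val_def a_def less_imp_neq[symmetric])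
  finally have mon: "(\<Prod>k<K. monom_val (C k) (\<lambda>i. a i / d (V - C k)) n) /
      (\<Prod>k<K. monom_val (S k) (\<lambda>i. a i / d (V - S k)) n) = monom_val V y n" .
  have "(\<Prod>k<K. d V / d (V - C k)) / (\<Prod>k<K. d V / d (V - S k)) = d V"
    unfolding d_def using nz by (rule prod_normalizer_ratio)
  then have nrm: "(\<Prod>k<K. (d V / d (V - C k)) ^ r) / (\<Prod>k<K. (d V / d (V - S k)) ^ r) = d V ^ r"
    by (simp flip: prod_power_distrib power_divide)
  have "(\<Prod>D\<in>max_cliques G. mult_mass D r (mult_param G y D) n) /
      (\<Prod>D\<in>min_separators G. mult_mass D r (mult_param G y D) n ^ sep_mult G D) =
      (\<Prod>k<K. mult_mass (C k) r (mult_param G y (C k)) n) /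
      (\<Prod>k<K. mult_mass (S k) r (mult_param G y (S k)) n)"
    using prod_min_separators[OF Cs, of "\<lambda>D. mult_mass D r (mult_param G y D) n", OF mult_mass_empty]
    by (simp only: prod_max_cliques)
  also have "\<dots> = mult_coeff G r n * monom_val V y n / d V ^ r"
    by (simp add: mass clique_C clique_S prod.distrib prod_dividef flip: coeff mon nrm)
  finally show ?thesis by (simp add: DV)
qed

end

theorem proposition3p12:
  fixes G :: "'v graph"
  assumes "finite_simple_graph G" and "decomposable G"
  shows
    "(\<forall>(r::real) x (M :: 'w measure) N.
        0 < r \<and> x \<in> M_set G \<and> nm_graph M N G r x \<longrightarrow>
        (\<forall>n \<in> multi_indices G.
           measure M {\<omega> \<in> space M. N \<omega> = n} =
             (\<Prod>C \<in> max_cliques G. nm_mass C r (nm_param G x C) n) /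
             (\<Prod>S \<in> min_separators G. nm_mass S r (nm_param G x S) n ^ sep_mult G S)))
     \<and>
     (\<forall>(r::nat) y (M :: 'u measure) N.
        1 \<le> r \<and> (\<forall>i \<in> verts G. 0 < y i) \<and> mult_graph M N G r y \<longrightarrow>
        (\<forall>n \<in> mult_support G r.
           measure M {\<omega> \<in> space M. N \<omega> = n} =
             (\<Prod>C \<in> max_cliques G. mult_mass C r (mult_param G y C) n) /
             (\<Prod>S \<in> min_separators G. mult_mass S r (mult_param G y S) n ^ sep_mult G S)))"
proof -
  have G: "perfectly_ordered_graph G (some_perfect_ordering G)"
    using assms(1) perfect_ordering_some[OF assms] by (rule perfectly_ordered_graph.intro)
  show ?thesis
  proof (intro conjI allI impI ballI)
    fix r :: real and x and M :: "'w measure" and N n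
    assume h: "0 < r \<and> x \<in> M_set G \<and> nm_graph M N G r x" and n: "n \<in> multi_indices G"
    then have "measure M {\<omega> \<in> space M. N \<omega> = n} =
        nm_coeff G r n * monom_val (verts G) x n * Delta G x powr r"
      by (simp add: nm_graph_def has_mass_function_def)
    also have "\<dots> = (\<Prod>C \<in> max_cliques G. nm_mass C r (nm_param G x C) n) /
        (\<Prod>S \<in> min_separators G. nm_mass S r (nm_param G x S) n ^ sep_mult G S)"
      using h n by (intro perfectly_ordered_graph.nm_mass_factorization[OF G refl]) auto
    finally show "measure M {\<omega> \<in> space M. N \<omega> = n} = \<dots>" .
  next
    fix r :: nat and y and M :: "'u measure" and N n
    assume h: "1 \<le> r \<and> (\<forall>i \<in> verts G. 0 < y i) \<and> mult_graph M N G r y"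
      and n: "n \<in> mult_support G r"
    then have "measure M {\<omega> \<in> space M. N \<omega> = n} =
        mult_coeff G r n * monom_val (verts G) y n / delta G y ^ r"
      by (simp add: mult_graph_def has_mass_function_def)
    also have "\<dots> = (\<Prod>C \<in> max_cliques G. mult_mass C r (mult_param G y C) n) /
        (\<Prod>S \<in> min_separators G. mult_mass S r (mult_param G y S) n ^ sep_mult G S)"
      using h n by (intro perfectly_ordered_graph.mult_mass_factorization[OF G refl]) auto
    finally show "measure M {\<omega> \<in> space M. N \<omega> = n} = \<dots>" .
  qed
qed

end
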